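(* Let $A$ be a commutative unital locally convex algebra, $G$ a compact abelian group and $(A,G,\alpha)$ a dynamical system. If each isotypic component $A_{\varphi}$, $\varphi\in\widehat{G}$, contains an invertible element, then the dynamical system $(A,G,\alpha)$ is free.
   Context: The ground field is $\mathbb{C}$. A dynamical system $(A,G,\alpha)$ consists of a unital locally convex algebra $A$ (jointly continuous multiplication), a topological group $G$ and a group homomorphism $\alpha:G\to\operatorname{Aut}(A)$ such that $(g,a)\mapsto\alpha(g)(a)$ is continuous on $G\times A$. $\Gamma_A$ is the set of nonzero algebra homomorphisms $A\to\mathbb{C}$. $\widehat{G}$ is the group of continuous homomorphisms $G\to\mathbb{T}$, and for $\varphi\in\widehat{G}$ the isotypic component is $A_{\varphi}:=\{a\in A:(\forall g\in G)\ \alpha(g)(a)=\varphi(g)\cdot a\}$. "Invertible" means invertible in $A$. For a continuous representation $(\pi,V)$ of $G$ (on a locally convex space), $\Gamma_AV:=\{s\in A\otimes V:(\forall g\in G)\ (\alpha(g)\otimes\operatorname{id}_V)(s)=(\operatorname{id}_A\otimes\pi(g^{-1}))(s)\}$. The system $(A,G,\alpha)$ (with $A$ commutative) is called free if there is a family $(\pi_j,V_j)_{j\in J}$ of continuous representations separating the points of $G$ (for each $g\ne 1_G$ some $\pi_j(g)\neq\operatorname{id}_{V_j}$) such that for all $j\in J$ and $\chi\in\Gamma_A$ the map $\Gamma_AV_j\to V_j$, $a\otimes v\mapsto\chi(a)v$ (the restriction of $\chi\otimes\operatorname{id}_{V_j}$) is surjective. *)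

theory Defs
  imports "HOL-Analysis.Analysis" "HOL-Algebra.Algebra"
begin

text \<open>
  Algebras and representation spaces are records with an explicit carrier, so that a quantifier
  can range over families of vector spaces. Topological groups are types of class
  \<^class>\<open>topological_group_add\<close>; the group law is written additively throughout,
  so \<open>-g\<close> is the inverse of \<open>g\<close> and \<open>0\<close> is the identity.
\<close>

definition complex_ring :: "complex ring"
  where "complex_ring = \<lparr>carrier = UNIV, mult = (*), one = 1, ring.zero = 0, add = (+)\<rparr>"


section \<open>Locally convex spaces and algebras\<close>

text \<open>Hausdorff is not part of the definition; it is required of representation spaces below.\<close>

locale locally_convex_space = Module.module complex_ring V
  for V :: "(complex, 'v, 'm) module_scheme" (structure) +
  fixes T :: "'v topology"
  assumes topspace_eq: "topspace T = carrier V"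
    and continuous_add:
      "continuous_map (prod_topology T T) T (\<lambda>(x, y). x \<oplus>\<^bsub>V\<^esub> y)"
    and continuous_smult:
      "continuous_map (prod_topology euclidean T) T (\<lambda>(c, x). c \<odot>\<^bsub>V\<^esub> x)"
    and locally_convex:
      "\<lbrakk>openin T U; \<zero>\<^bsub>V\<^esub> \<in> U\<rbrakk> \<Longrightarrow>
        \<exists>W. openin T W \<and> \<zero>\<^bsub>V\<^esub> \<in> W \<and> W \<subseteq> U \<and>
          (\<forall>x\<in>W. \<forall>y\<in>W. \<forall>t\<in>{0..1}.
            complex_of_real t \<odot>\<^bsub>V\<^esub> x \<oplus>\<^bsub>V\<^esub> complex_of_real (1 - t) \<odot>\<^bsub>V\<^esub> y \<in> W)"

locale locally_convex_algebra = locally_convex_space A T + Ring.ring A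
  for A :: "(complex, 'a, 'm) module_scheme" (structure) and T :: "'a topology" +
  assumes smult_mult_left:
      "\<lbrakk>x \<in> carrier A; y \<in> carrier A\<rbrakk> \<Longrightarrow>
        (c \<odot>\<^bsub>A\<^esub> x) \<otimes>\<^bsub>A\<^esub> y = c \<odot>\<^bsub>A\<^esub> (x \<otimes>\<^bsub>A\<^esub> y)"
    and smult_mult_right:
      "\<lbrakk>x \<in> carrier A; y \<in> carrier A\<rbrakk> \<Longrightarrow>
        x \<otimes>\<^bsub>A\<^esub> (c \<odot>\<^bsub>A\<^esub> y) = c \<odot>\<^bsub>A\<^esub> (x \<otimes>\<^bsub>A\<^esub> y)"
    and continuous_mult:
      "continuous_map (prod_topology T T) T (\<lambda>(x, y). x \<otimes>\<^bsub>A\<^esub> y)"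

definition linear_endo :: "(complex, 'v, 'm) module_scheme \<Rightarrow> ('v \<Rightarrow> 'v) \<Rightarrow> bool"
  where "linear_endo V f \<longleftrightarrow>
    f \<in> carrier V \<rightarrow> carrier V \<and>
    (\<forall>x\<in>carrier V. \<forall>y\<in>carrier V. f (x \<oplus>\<^bsub>V\<^esub> y) = f x \<oplus>\<^bsub>V\<^esub> f y) \<and>
    (\<forall>c. \<forall>x\<in>carrier V. f (c \<odot>\<^bsub>V\<^esub> x) = c \<odot>\<^bsub>V\<^esub> f x)"

definition algebra_aut :: "(complex, 'a, 'm) module_scheme \<Rightarrow> ('a \<Rightarrow> 'a) set"
  where "algebra_aut A =
    {f. f \<in> ring_hom A A \<and> linear_endo A f \<and> bij_betw f (carrier A) (carrier A)}"

definition algebra_characters :: "(complex, 'a, 'm) module_scheme \<Rightarrow> ('a \<Rightarrow> complex) set"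
  where "algebra_characters A =
    {\<omega>. (\<forall>x\<in>carrier A. \<forall>y\<in>carrier A. \<omega> (x \<oplus>\<^bsub>A\<^esub> y) = \<omega> x + \<omega> y) \<and>
         (\<forall>c. \<forall>x\<in>carrier A. \<omega> (c \<odot>\<^bsub>A\<^esub> x) = c * \<omega> x) \<and>
         (\<forall>x\<in>carrier A. \<forall>y\<in>carrier A. \<omega> (x \<otimes>\<^bsub>A\<^esub> y) = \<omega> x * \<omega> y) \<and>
         (\<exists>x\<in>carrier A. \<omega> x \<noteq> 0)}"


section \<open>Dynamical systems and representations\<close>

locale dynamical_system = locally_convex_algebra A T
  for A :: "(complex, 'a, 'm) module_scheme" (structure) and T :: "'a topology" +
  fixes \<alpha> :: "'g::topological_group_add \<Rightarrow> 'a \<Rightarrow> 'a"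
  assumes action_aut: "\<alpha> g \<in> algebra_aut A"
    and action_hom: "x \<in> carrier A \<Longrightarrow> \<alpha> (g + h) x = \<alpha> g (\<alpha> h x)"
    and action_continuous:
      "continuous_map (prod_topology euclidean T) T (\<lambda>(g, x). \<alpha> g x)"

definition group_characters :: "('g::topological_group_add \<Rightarrow> complex) set"
  where "group_characters =
    {\<phi>. continuous_on UNIV \<phi> \<and> (\<forall>g. norm (\<phi> g) = 1) \<and> (\<forall>g h. \<phi> (g + h) = \<phi> g * \<phi> h)}"

definition isotypic_component ::
    "(complex, 'a, 'm) module_scheme \<Rightarrow> ('g \<Rightarrow> 'a \<Rightarrow> 'a) \<Rightarrow> ('g \<Rightarrow> complex) \<Rightarrow> 'a set"
  where "isotypic_component A \<alpha> \<phi> = {a \<in> carrier A. \<forall>g. \<alpha> g a = \<phi> g \<odot>\<^bsub>A\<^esub> a}"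

locale continuous_representation = locally_convex_space V T
  for V :: "(complex, 'v, 'm) module_scheme" (structure) and T :: "'v topology" +
  fixes \<pi> :: "'g::topological_group_add \<Rightarrow> 'v \<Rightarrow> 'v"
  assumes hausdorff: "Hausdorff_space T"
    and rep_linear: "linear_endo V (\<pi> g)"
    and rep_zero: "v \<in> carrier V \<Longrightarrow> \<pi> 0 v = v"
    and rep_add: "v \<in> carrier V \<Longrightarrow> \<pi> (g + h) v = \<pi> g (\<pi> h v)"
    and rep_continuous:
      "continuous_map (prod_topology euclidean T) T (\<lambda>(g, v). \<pi> g v)"


section \<open>The algebraic tensor product\<close>

text \<open>
  \<open>A \<otimes> V\<close> is the free abelian group on \<open>A \<times> V\<close> modulo the subgroup generated by the
  biadditivity relations and \<open>(c a, v) - (a, c v)\<close> for complex \<open>c\<close>. Its elements are cosets.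
\<close>

definition tensor_relations ::
    "(complex, 'a, 'm) module_scheme \<Rightarrow> (complex, 'v, 'n) module_scheme \<Rightarrow> ('a \<times> 'v \<Rightarrow>\<^sub>0 int) set"
  where "tensor_relations A V =
    {frag_of (a \<oplus>\<^bsub>A\<^esub> b, v) - frag_of (a, v) - frag_of (b, v) | a b v.
       a \<in> carrier A \<and> b \<in> carrier A \<and> v \<in> carrier V} \<union>
    {frag_of (a, v \<oplus>\<^bsub>V\<^esub> w) - frag_of (a, v) - frag_of (a, w) | a v w.
       a \<in> carrier A \<and> v \<in> carrier V \<and> w \<in> carrier V} \<union>
    {frag_of (c \<odot>\<^bsub>A\<^esub> a, v) - frag_of (a, c \<odot>\<^bsub>V\<^esub> v) | c a v.
       a \<in> carrier A \<and> v \<in> carrier V}"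

definition tensor_kernel ::
    "(complex, 'a, 'm) module_scheme \<Rightarrow> (complex, 'v, 'n) module_scheme \<Rightarrow> ('a \<times> 'v \<Rightarrow>\<^sub>0 int) set"
  where "tensor_kernel A V =
    generate (free_Abelian_group (carrier A \<times> carrier V)) (tensor_relations A V)"

definition tensor_class ::
    "(complex, 'a, 'm) module_scheme \<Rightarrow> (complex, 'v, 'n) module_scheme \<Rightarrow>
      ('a \<times> 'v \<Rightarrow>\<^sub>0 int) \<Rightarrow> ('a \<times> 'v \<Rightarrow>\<^sub>0 int) set"
  where "tensor_class A V x =
    tensor_kernel A V #>\<^bsub>free_Abelian_group (carrier A \<times> carrier V)\<^esub> x"

definition tensor_product ::
    "(complex, 'a, 'm) module_scheme \<Rightarrow> (complex, 'v, 'n) module_scheme \<Rightarrow>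
      ('a \<times> 'v \<Rightarrow>\<^sub>0 int) set monoid"
  where "tensor_product A V =
    free_Abelian_group (carrier A \<times> carrier V) Mod tensor_kernel A V"

text \<open>
  The maps \<open>f \<otimes> h\<close> on \<open>A \<otimes> V\<close> and \<open>\<omega> \<otimes> id : A \<otimes> V \<rightarrow> V\<close> are computed on representatives
  of the coset \<open>s\<close>; for linear \<open>f\<close>, \<open>h\<close>, \<open>\<omega>\<close> the set below is a singleton.
\<close>

definition tensor_map ::
    "(complex, 'a, 'm) module_scheme \<Rightarrow> (complex, 'v, 'n) module_scheme \<Rightarrow>
      ('a \<Rightarrow> 'a) \<Rightarrow> ('v \<Rightarrow> 'v) \<Rightarrow> ('a \<times> 'v \<Rightarrow>\<^sub>0 int) set \<Rightarrow> ('a \<times> 'v \<Rightarrow>\<^sub>0 int) set"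
  where "tensor_map A V f h s =
    the_elem ((\<lambda>x. tensor_class A V (frag_extend (\<lambda>(a, v). frag_of (f a, h v)) x)) ` s)"

definition tensor_eval ::
    "(complex, 'v, 'n) module_scheme \<Rightarrow> ('a \<Rightarrow> complex) \<Rightarrow> ('a \<times> 'v \<Rightarrow>\<^sub>0 int) set \<Rightarrow> 'v"
  where "tensor_eval V \<omega> s =
    the_elem ((\<lambda>x. \<Oplus>\<^bsub>V\<^esub>p\<in>Poly_Mapping.keys x.
      (of_int (Poly_Mapping.lookup x p) * \<omega> (fst p)) \<odot>\<^bsub>V\<^esub> snd p) ` s)"


section \<open>Free dynamical systems\<close>

definition equivariant_tensors ::
    "(complex, 'a, 'm) module_scheme \<Rightarrow> ('g::group_add \<Rightarrow> 'a \<Rightarrow> 'a) \<Rightarrow>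
      (complex, 'v, 'n) module_scheme \<Rightarrow> ('g \<Rightarrow> 'v \<Rightarrow> 'v) \<Rightarrow> ('a \<times> 'v \<Rightarrow>\<^sub>0 int) set set"
  where "equivariant_tensors A \<alpha> V \<pi> =
    {s \<in> carrier (tensor_product A V).
      \<forall>g. tensor_map A V (\<alpha> g) id s = tensor_map A V id (\<pi> (- g)) s}"

text \<open>
  HOL cannot quantify over the type underlying the representation spaces, so they are subsets of
  the fixed type \<open>'a \<times> 'g \<Rightarrow> complex\<close>. This loses no generality. Given a family of representations
  on arbitrary spaces as in the definition, start in each \<open>V\<close> from at most one vector per
  \<open>g \<noteq> 0\<close>, namely one moved by \<open>g\<close> if there is any, and close under addition, complex multiples,
  \<open>\<pi>\<close> and the vectors occurring in one chosen preimage in \<open>A \<otimes> V\<close> for every algebra character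
  \<open>\<omega>\<close> and every vector reached. The result is an invariant subspace with at most as many elements
  as \<open>'a \<times> 'g \<Rightarrow> complex\<close> which can replace \<open>V\<close>: it moves under the same group elements, and
  \<open>A \<otimes> W \<rightarrow> A \<otimes> V\<close> is injective for a subspace \<open>W\<close>, so the chosen preimages stay equivariant.

  Repetitions in the family are irrelevant, so the family is a set \<open>\<R>\<close> of triples consisting of
  the space, its topology and the representation.
\<close>

definition free_system ::
    "(complex, 'a) module \<Rightarrow> ('g::topological_group_add \<Rightarrow> 'a \<Rightarrow> 'a) \<Rightarrow> bool"
  where "free_system A \<alpha> \<longleftrightarrow>
    (\<exists>\<R> :: ((complex, 'a \<times> 'g \<Rightarrow> complex) module \<times> ('a \<times> 'g \<Rightarrow> complex) topology \<times>
             ('g \<Rightarrow> ('a \<times> 'g \<Rightarrow> complex) \<Rightarrow> ('a \<times> 'g \<Rightarrow> complex))) set.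
      (\<forall>(V, T, \<pi>)\<in>\<R>. continuous_representation V T \<pi>) \<and>
      (\<forall>g. g \<noteq> 0 \<longrightarrow> (\<exists>(V, T, \<pi>)\<in>\<R>. \<exists>v\<in>carrier V. \<pi> g v \<noteq> v)) \<and>
      (\<forall>(V, T, \<pi>)\<in>\<R>. \<forall>\<omega>\<in>algebra_characters A.
        tensor_eval V \<omega> ` equivariant_tensors A \<alpha> V \<pi> = carrier V))"

end

theory Submission
  imports Defs
begin

text \<open>
  A compact Hausdorff abelian group has enough continuous characters to separate its points, and for
  the representation of the group on the complex line by a character \<open>\<phi>\<close> the surjectivity required
  of a free system is immediate: if \<open>a\<close> is an invertible element of the isotypic component of the
  inverse of \<open>\<phi>\<close>, then each tensor of \<open>a\<close> with a vector of the line is equivariant, and an algebra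
  character \<open>\<omega>\<close> multiplies that vector by \<open>\<omega> a\<close>, which is not 0. This is
  \<open>tensor_eval_line_surjective\<close>. It remains to prove the separation of points, which is
  \<open>group_characters_separate\<close>.

  The invariant mean of a continuous function \<open>f\<close> is the only constant that is a uniform limit of
  averages of \<open>f\<close> over finitely many translates. It exists because averaging over translates of a
  small neighbourhood that cover the group levels out any drop of \<open>f\<close> by a definite amount
  (\<open>avg_spread\<close>, \<open>is_mean_real_ex\<close>), and it is additive because the group is abelian. With this mean
  the continuous functions form a commutative algebra with involution under convolution, and an inner
  product.

  Characters are found as minimal idempotents of this algebra. Power iteration for a hermitian function
  \<open>r \<noteq> 0\<close> converges uniformly to a hermitian idempotent \<open>q \<noteq> 0\<close> on which \<open>r * r\<close> acts by a
  positive scalar (\<open>power_method\<close>). Hermitian idempotents \<open>q \<noteq> 0\<close> satisfy \<open>q 0 \<ge> 1\<close>, so there is a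
  minimal one below each of them (\<open>minimal_idempotent_ex\<close>). Power iteration within the ideal of a
  minimal \<open>q\<close> can only return \<open>q\<close>, which forces the ideal to consist of the multiples of \<open>q\<close>
  (\<open>minimal_one_dimensional\<close>). The translates of \<open>q\<close> lie in the ideal, and therefore \<open>q / q 0\<close> is a
  character. To obtain a character that is not 1 at a given \<open>g \<noteq> 0\<close>, start with \<open>r = star f * f\<close>,
  where \<open>f\<close> is the difference of some continuous function and its translate by \<open>g\<close>: all characters
  that are 1 at \<open>g\<close> are annihilated by \<open>f\<close>.
\<close>

section \<open>Averages over translates\<close>

text \<open>
  This uniform version of the tube lemma yields the modulus of uniform continuity of a
  continuous function on the group, the continuity of means depending on a parameter, and the
  interchange of two means.
\<close>

lemma tube_uniform:
  fixes F :: "'x::topological_space \<Rightarrow> 'y::topological_space \<Rightarrow> 'b::real_normed_vector"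
  assumes "compact (UNIV :: 'y set)" "continuous_on UNIV (\<lambda>(x, y). F x y)" "e > 0"
  obtains N where "open N" "x0 \<in> N" "\<And>x y. x \<in> N \<Longrightarrow> norm (F x y - F x0 y) < e"
proof -
  let ?W = "{p. norm (F (fst p) (snd p) - F x0 (snd p)) < e}"
  have F: "continuous_on UNIV (\<lambda>p. F (u p) (v p))"
    if "continuous_on UNIV u" "continuous_on UNIV v" for u :: "'x \<times> 'y \<Rightarrow> 'x" and v
    using continuous_on_compose2[OF assms(2), of UNIV "\<lambda>p. (u p, v p)"] that
    by (simp add: continuous_on_Pair)
  have "open ?W"
    by (intro open_Collect_less continuous_intros F)
  moreover have "{x0} \<times> UNIV \<subseteq> ?W"
    using assms(3) by auto
  ultimately obtain N where "x0 \<in> N" "open N" "N \<times> UNIV \<subseteq> ?W"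
    using Elementary_Topology.tube_lemma[OF assms(1), of ?W x0] by auto
  then have "norm (F x y - F x0 y) < e" if "x \<in> N" for x y
    using that by (auto dest!: subsetD[of _ _ "(x, y)"])
  with \<open>x0 \<in> N\<close> \<open>open N\<close> show thesis
    by (intro that)
qed

definition avg :: "'g::ab_group_add list \<Rightarrow> ('g \<Rightarrow> 'b::real_normed_vector) \<Rightarrow> 'g \<Rightarrow> 'b"
  where "avg ys f x = (\<Sum>y\<leftarrow>ys. f (x + y)) /\<^sub>R real (length ys)"

definition list_sums :: "'g::ab_group_add list \<Rightarrow> 'g list \<Rightarrow> 'g list"
  where "list_sums ys zs = map (\<lambda>(y, z). y + z) (List.product ys zs)"

text \<open>
  For a continuous function on a compact abelian group the only such \<open>c\<close> is its integral against
  normalised Haar measure.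
\<close>

definition is_mean :: "('g::ab_group_add \<Rightarrow> 'b::real_normed_vector) \<Rightarrow> 'b \<Rightarrow> bool"
  where "is_mean f c \<longleftrightarrow> (\<forall>e>0. \<exists>ys. ys \<noteq> [] \<and> (\<forall>x. norm (avg ys f x - c) \<le> e))"

lemma sum_list_const_scaleR: "(\<Sum>y\<leftarrow>ys. c) = real (length ys) *\<^sub>R c"
  for c :: "'b::real_vector"
  by (induction ys) (simp_all add: scaleR_left_distrib)

lemma sum_list_scaleR: "(\<Sum>y\<leftarrow>ys. a *\<^sub>R h y) = a *\<^sub>R (\<Sum>y\<leftarrow>ys. h y)"
  for h :: "'y \<Rightarrow> 'b::real_vector"
  by (induction ys) (simp_all add: scaleR_right_distrib)

lemma linear_avg:
  assumes "linear L"
  shows "L (avg ys f x) = avg ys (\<lambda>x. L (f x)) x"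
proof -
  interpret linear L by fact
  have "L (\<Sum>y\<leftarrow>ys. f (x + y)) = (\<Sum>y\<leftarrow>ys. L (f (x + y)))"
    by (induction ys) (simp_all add: add zero)
  then show ?thesis
    by (simp add: avg_def scale)
qed

lemma avg_add: "avg ys (\<lambda>x. f x + g x) x = avg ys f x + avg ys g x"
  by (simp add: avg_def sum_list_addf scaleR_right_distrib)

lemma avg_const: "ys \<noteq> [] \<Longrightarrow> avg ys (\<lambda>x. c) x = c"
  by (simp add: avg_def sum_list_const_scaleR)

lemma avg_diff: "avg ys (\<lambda>x. f x - g x) x = avg ys f x - avg ys g x"
  by (simp add: avg_def sum_list_subtractf scaleR_right_diff_distrib)

lemma norm_avg_le: "norm (avg ys f x) \<le> avg ys (\<lambda>x. norm (f x)) x"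
proof -
  have "norm (\<Sum>y\<leftarrow>ys. f (x + y)) \<le> (\<Sum>y\<leftarrow>ys. norm (f (x + y)))"
    by (induction ys) (auto intro: norm_triangle_mono)
  then show ?thesis
    by (simp add: avg_def mult_left_mono)
qed

lemma avg_le:
  fixes f :: "'g::ab_group_add \<Rightarrow> real"
  assumes "ys \<noteq> []" "\<And>x. f x \<le> B"
  shows "avg ys f x \<le> B"
proof -
  have "(\<Sum>y\<leftarrow>ys. f (x + y)) \<le> (\<Sum>y\<leftarrow>ys. B)"
    by (intro sum_list_mono assms)
  then have "avg ys f x \<le> avg ys (\<lambda>_. B) x"
    by (simp add: avg_def mult_left_mono)
  then show ?thesis
    using assms(1) by (simp add: avg_const)
qed

lemma norm_avg_diff_le:
  assumes "ys \<noteq> []" "\<And>x. norm (f x - c) \<le> e"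
  shows "norm (avg ys f x - c) \<le> e"
proof -
  have "avg ys f x - c = avg ys (\<lambda>x. f x - c) x"
    using assms(1) by (simp add: avg_diff avg_const)
  then show ?thesis
    using norm_avg_le[of ys "\<lambda>x. f x - c" x] avg_le[OF assms(1), of "\<lambda>x. norm (f x - c)" e x] assms(2)
    by simp
qed

lemma list_sums_eq_Nil: "list_sums ys zs = [] \<longleftrightarrow> ys = [] \<or> zs = []"
proof -
  have "length (list_sums ys zs) = length ys * length zs"
    by (simp add: list_sums_def)
  then show ?thesis
    by (metis length_0_conv mult_eq_0_iff)
qed

lemma avg_avg:
  "avg ys (avg zs f) x = avg (list_sums ys zs) f x"
proof -
  have "(\<Sum>y\<leftarrow>ys. (\<Sum>z\<leftarrow>zs. f (x + y + z))) =
        (\<Sum>w\<leftarrow>list_sums ys zs. f (x + w))"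
    by (induction ys) (simp_all add: list_sums_def o_def add.assoc)
  moreover have "length (list_sums ys zs) = length ys * length zs"
    by (simp add: list_sums_def)
  ultimately show ?thesis
    by (simp add: avg_def sum_list_scaleR mult.commute)
qed

text \<open>
  Here the commutativity of the group enters: averages over different lists of translates commute, so
  that one can be applied without spoiling what another has achieved.
\<close>

lemma avg_commute: "avg ys (avg zs f) x = avg zs (avg ys f) x"
proof -
  have "(\<Sum>y\<leftarrow>ys. (\<Sum>z\<leftarrow>zs. f (x + y + z))) = (\<Sum>z\<leftarrow>zs. (\<Sum>y\<leftarrow>ys. f (x + z + y)))"
    by (induction ys) (simp_all add: sum_list_addf add.commute add.left_commute)
  then show ?thesis
    by (simp add: avg_def sum_list_scaleR mult.commute)
qed

lemma avg_shift: "avg ys (\<lambda>x. f (a + x)) x = avg ys f (a + x)"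
  by (simp add: avg_def add.assoc)

lemma avg_reflect: "avg ys (\<lambda>x. f (- x)) x = avg (map uminus ys) f (- x)"
  by (simp add: avg_def o_def add.commute)

text \<open>
  Averaging keeps a function near \<open>c\<close> if it was near \<open>c\<close> everywhere. So the composition of an
  average that flattens \<open>f\<close> with one that flattens \<open>g\<close> flattens both. Uniqueness and additivity
  of the mean follow from this.
\<close>

lemma common_avg:
  assumes "is_mean f c" "is_mean g d" "e > 0"
  shows "\<exists>ys. ys \<noteq> [] \<and> (\<forall>x. norm (avg ys f x - c) \<le> e \<and> norm (avg ys g x - d) \<le> e)"
proof -
  obtain ys where ys: "ys \<noteq> []" "\<And>x. norm (avg ys f x - c) \<le> e"
    using assms unfolding is_mean_def by metis
  obtain zs where zs: "zs \<noteq> []" "\<And>x. norm (avg zs g x - d) \<le> e"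
    using assms unfolding is_mean_def by metis
  let ?ws = "list_sums ys zs"
  have "?ws \<noteq> []"
    using ys(1) zs(1) by (simp add: list_sums_eq_Nil)
  moreover have "norm (avg ?ws f x - c) \<le> e" for x
    using norm_avg_diff_le[OF zs(1) ys(2)] by (simp add: avg_avg[symmetric] avg_commute[of ys zs])
  moreover have "norm (avg ?ws g x - d) \<le> e" for x
    using norm_avg_diff_le[OF ys(1) zs(2)] by (simp add: avg_avg[symmetric])
  ultimately show ?thesis by blast
qed

lemma is_mean_unique:
  assumes "is_mean f c" "is_mean f d"
  shows "c = d"
proof (rule ccontr)
  assume "c \<noteq> d"
  then have "norm (c - d) / 3 > 0" by simp
  then obtain ys where
    ys: "\<And>x. norm (avg ys f x - c) \<le> norm (c - d) / 3" "\<And>x. norm (avg ys f x - d) \<le> norm (c - d) / 3"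
    using common_avg[OF assms] by metis
  have "norm (c - d) \<le> norm (avg ys f 0 - c) + norm (avg ys f 0 - d)"
    using norm_triangle_ineq4[of "avg ys f 0 - d" "avg ys f 0 - c"] by simp
  also have "\<dots> \<le> norm (c - d) / 3 + norm (c - d) / 3"
    by (intro add_mono ys)
  finally show False
    using \<open>c \<noteq> d\<close> by simp
qed

lemma is_mean_linear:
  assumes "bounded_linear L" "is_mean f c"
  shows "is_mean (\<lambda>x. L (f x)) (L c)"
  unfolding is_mean_def
proof (intro allI impI)
  interpret bounded_linear L by fact
  fix e :: real assume "e > 0"
  obtain K where K: "K > 0" "\<And>x. norm (L x) \<le> norm x * K"
    using pos_bounded by blast
  from \<open>e > 0\<close> K(1) have "e / K > 0" by simp
  then obtain ys where ys: "ys \<noteq> []" "\<And>x. norm (avg ys f x - c) \<le> e / K"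
    using assms(2) by (metis is_mean_def)
  have "norm (avg ys (\<lambda>x. L (f x)) x - L c) \<le> e" for x
  proof -
    have "avg ys (\<lambda>x. L (f x)) x - L c = L (avg ys f x - c)"
      by (simp add: linear_avg[OF linear_axioms] diff)
    also have "norm \<dots> \<le> norm (avg ys f x - c) * K"
      by (rule K)
    also have "\<dots> \<le> e / K * K"
      using K(1) ys(2) by (intro mult_right_mono) auto
    finally show ?thesis using K(1) by simp
  qed
  with ys(1) show "\<exists>ys. ys \<noteq> [] \<and> (\<forall>x. norm (avg ys (\<lambda>x. L (f x)) x - L c) \<le> e)"
    by blast
qed

lemma is_mean_add:
  assumes "is_mean f c" "is_mean g d"
  shows "is_mean (\<lambda>x. f x + g x) (c + d)"
  unfolding is_mean_def
proof (intro allI impI)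
  fix e :: real assume "e > 0"
  then have "e / 2 > 0" by simp
  then obtain ys where ys: "ys \<noteq> []"
    "\<And>x. norm (avg ys f x - c) \<le> e / 2" "\<And>x. norm (avg ys g x - d) \<le> e / 2"
    using common_avg[OF assms] by metis
  have "norm (avg ys (\<lambda>x. f x + g x) x - (c + d)) \<le> e" for x
    using norm_diff_triangle_ineq[of "avg ys f x" "avg ys g x" c d] ys(2,3)[of x]
    by (simp add: avg_add)
  with ys(1) show "\<exists>ys. ys \<noteq> [] \<and> (\<forall>x. norm (avg ys (\<lambda>x. f x + g x) x - (c + d)) \<le> e)"
    by blast
qed

lemma is_mean_const: "is_mean (\<lambda>x. c) c"
  by (auto simp: is_mean_def avg_const intro!: exI[of _ "[0]"])

lemma is_mean_shift: "is_mean f c \<Longrightarrow> is_mean (\<lambda>x. f (a + x)) c"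
  unfolding is_mean_def avg_shift by blast

lemma is_mean_reflect:
  assumes "is_mean f c"
  shows "is_mean (\<lambda>x. f (- x)) c"
  unfolding is_mean_def
proof (intro allI impI)
  fix e :: real assume "e > 0"
  then obtain ys where ys: "ys \<noteq> []" "\<forall>x. norm (avg ys f x - c) \<le> e"
    using assms by (auto simp: is_mean_def)
  then show "\<exists>ys. ys \<noteq> [] \<and> (\<forall>x. norm (avg ys (\<lambda>x. f (- x)) x - c) \<le> e)"
    by (intro exI[of _ "map uminus ys"]) (simp add: avg_reflect o_def)
qed

lemma is_mean_avg:
  assumes "is_mean f c" "zs \<noteq> []"
  shows "is_mean (avg zs f) c"
  unfolding is_mean_def
  by (metis assms avg_commute is_mean_def norm_avg_diff_le)

lemma is_mean_le:
  fixes f :: "'g::ab_group_add \<Rightarrow> real"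
  assumes "is_mean f c" "\<And>x. f x \<le> B"
  shows "c \<le> B"
proof (rule field_le_epsilon)
  fix e :: real assume "e > 0"
  then obtain ys where ys: "ys \<noteq> []" "\<forall>x. norm (avg ys f x - c) \<le> e"
    using assms by (auto simp: is_mean_def)
  with avg_le[OF ys(1), of f B 0] assms(2) show "c \<le> B + e"
    by (smt (verit, best) real_norm_def)
qed

lemma norm_is_mean_le:
  assumes "is_mean f c" "is_mean (\<lambda>x. norm (f x)) d"
  shows "norm c \<le> d"
proof (rule field_le_epsilon)
  fix e :: real assume "e > 0"
  then have "e / 2 > 0" by simp
  then obtain ys where ys:
    "\<And>x. norm (avg ys f x - c) \<le> e / 2" "\<And>x. norm (avg ys (\<lambda>x. norm (f x)) x - d) \<le> e / 2"
    using common_avg[OF assms] by metis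
  have "norm c \<le> norm (avg ys f 0) + norm (avg ys f 0 - c)"
    using norm_triangle_ineq4[of "avg ys f 0" "avg ys f 0 - c"] by simp
  also have "\<dots> \<le> avg ys (\<lambda>x. norm (f x)) 0 + e / 2"
    by (intro add_mono norm_avg_le ys)
  also have "\<dots> \<le> d + e / 2 + e / 2"
    using abs_le_D1[OF ys(2)[of 0, unfolded real_norm_def]] by simp
  finally show "norm c \<le> d + e" by simp
qed

context
  assumes compact_group: "compact (UNIV :: 'g::topological_ab_group_add set)"
begin

lemma continuous_shift:
  fixes f :: "'g \<Rightarrow> 'b::topological_space"
  assumes "continuous_on UNIV f"
  shows "continuous_on UNIV (\<lambda>x. f (a + x))"
  by (rule continuous_on_compose2[OF assms]) (auto intro!: continuous_intros)

text \<open>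
  By compactness finitely many translates of \<open>U\<close> cover the group. In the form stated here, averaging
  over \<open>zs\<close> looks into every translate of \<open>U\<close>.
\<close>

lemma finite_translates_cover:
  assumes "open U" "(0 :: 'g) \<in> U"
  obtains zs where "zs \<noteq> []" "\<And>w. \<exists>z\<in>set zs. w + z \<in> U"
proof -
  let ?V = "\<lambda>z. (\<lambda>w. w + z) -` U"
  have "open (?V z)" for z
    by (rule open_vimage[OF assms(1)]) (intro continuous_intros)
  moreover have "UNIV \<subseteq> (\<Union>z\<in>UNIV. ?V z)"
  proof
    fix w
    have "w \<in> ?V (- w)" using assms(2) by simp
    then show "w \<in> (\<Union>z\<in>UNIV. ?V z)" by blast
  qed
  ultimately obtain Z where Z: "finite Z" "UNIV \<subseteq> (\<Union>z\<in>Z. ?V z)"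
    using compactE_image[OF compact_group, of UNIV ?V thesis] by blast
  obtain zs where zs: "set zs = Z"
    using finite_list[OF Z(1)] by blast
  have *: "\<exists>z\<in>set zs. w + z \<in> U" for w
    using Z(2) zs by auto
  then have "zs \<noteq> []" by (metis empty_iff empty_set)
  with * show thesis using that by blast
qed

text \<open>
  If \<open>F\<close> drops to \<open>B - d\<close> somewhere, it is at most \<open>B - d / 2\<close> on a whole translate of \<open>U\<close>, and
  every average over \<open>zs\<close> has at least one term from there. What matters is that the gain
  \<open>d / (2 * length zs)\<close> depends on \<open>F\<close> only through its modulus of continuity.
\<close>

lemma avg_spread:
  fixes F :: "'g \<Rightarrow> real"
  assumes zs: "\<And>w. \<exists>z\<in>set zs. w + z \<in> U"
    and U: "\<And>x u. u \<in> U \<Longrightarrow> F (x + u) \<le> F x + d / 2"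
    and B: "\<And>x. F x \<le> B" and x0: "F x0 \<le> B - d"
  shows "avg zs F x \<le> B - d / (2 * real (length zs))"
proof -
  obtain z where z: "z \<in> set zs" "(x - x0) + z \<in> U"
    using zs by blast
  have "F (x + z) \<le> B - d / 2"
    using U[OF z(2), of x0] x0 by (simp add: algebra_simps)
  moreover have "(\<Sum>y\<leftarrow>remove1 z zs. F (x + y)) \<le> (\<Sum>y\<leftarrow>remove1 z zs. B)"
    by (intro sum_list_mono B)
  moreover have "(\<Sum>y\<leftarrow>zs. F (x + y)) = F (x + z) + (\<Sum>y\<leftarrow>remove1 z zs. F (x + y))"
    by (rule sum_list_map_remove1[OF z(1)])
  moreover have "real (length (remove1 z zs)) = real (length zs) - 1"
    using z(1) length_pos_if_in_set[OF z(1)] by (simp add: length_remove1 of_nat_diff Suc_leI)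
  ultimately have "(\<Sum>y\<leftarrow>zs. F (x + y)) \<le> real (length zs) * B - d / 2"
    by (simp add: sum_list_triv algebra_simps)
  moreover have "length zs > 0"
    using z(1) by (cases zs) auto
  ultimately show ?thesis
    by (simp add: avg_def field_simps)
qed

lemma uniform_modulus:
  fixes f :: "'g \<Rightarrow> 'b::real_normed_vector"
  assumes "continuous_on UNIV f" "e > 0"
  obtains U where "open U" "0 \<in> U" "\<And>x u. u \<in> U \<Longrightarrow> norm (f (x + u) - f x) < e"
proof -
  have "continuous_on UNIV (\<lambda>(u, x). f (x + u))"
    unfolding case_prod_beta
    by (rule continuous_on_compose2[OF assms(1)]) (auto intro!: continuous_intros)
  from tube_uniform[OF compact_group this assms(2), of 0] obtain N where
    N: "open N" "0 \<in> N" "\<And>u x. u \<in> N \<Longrightarrow> norm (f (x + u) - f (x + 0)) < e"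
    by metis
  show thesis
    by (rule that[OF N(1,2)]) (use N(3) in simp)
qed

lemma continuous_bounded:
  fixes f :: "'g \<Rightarrow> 'b::real_normed_vector"
  assumes "continuous_on UNIV f"
  obtains B where "B > 0" "\<And>x. norm (f x) \<le> B"
  using compact_imp_bounded[OF compact_continuous_image[OF assms compact_group]]
  unfolding bounded_pos by auto

text \<open>
  The mean is the infimum \<open>M\<close> of all upper bounds of averages of \<open>f\<close>. An average that is bounded by
  nearly \<open>M\<close> must be nearly constant: if it still dropped by \<open>d\<close> somewhere, averaging once more
  would push it below \<open>M\<close> by \<open>avg_spread\<close>. This is no circle, because all averages of \<open>f\<close> inherit
  the modulus of continuity of \<open>f\<close>, so the gain is known before the average is chosen.
\<close>

lemma is_mean_real_ex:
  fixes f :: "'g \<Rightarrow> real"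
  assumes "continuous_on UNIV f"
  shows "\<exists>c. is_mean f c"
proof -
  define S where "S = {M. \<exists>ys. ys \<noteq> [] \<and> (\<forall>x. avg ys f x \<le> M)}"
  obtain B where B: "\<And>x. norm (f x) \<le> B"
    using continuous_bounded[OF assms] by blast
  have lower: "- B \<le> avg ys f x" if "ys \<noteq> []" for ys x
    using norm_avg_diff_le[OF that, of f 0 B x] B by (simp add: abs_le_iff)
  have "f x \<le> B" for x
    using B[of x] by simp
  then have "B \<in> S"
    unfolding S_def by (auto intro!: exI[of _ "[0]"] avg_le)
  have bdd: "bdd_below S"
  proof (rule bdd_belowI)
    fix K assume "K \<in> S"
    then obtain ys where "ys \<noteq> []" "\<And>x. avg ys f x \<le> K"
      unfolding S_def by blast
    with lower[of ys 0] show "- B \<le> K"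
      by (meson order_trans)
  qed
  define M where "M = Inf S"
  have "is_mean f M"
    unfolding is_mean_def
  proof (intro allI impI)
    fix d :: real assume "d > 0"
    then have "d / 2 > 0" by simp
    then obtain U where U: "open U" "0 \<in> U" "\<And>x u. u \<in> U \<Longrightarrow> norm (f (x + u) - f x) < d / 2"
      using uniform_modulus[OF assms] by metis
    obtain zs where zs: "zs \<noteq> []" "\<And>w. \<exists>z\<in>set zs. w + z \<in> U"
      using finite_translates_cover[OF U(1,2)] by blast
    \<comment> \<open>Half of the gain that \<open>avg_spread\<close> will provide, so that it outweighs the error \<open>e\<close>.\<close>
    define e where "e = d / (4 * real (length zs))"
    have "real (length zs) \<ge> 1"
      using zs(1) by (cases zs) auto
    then have e: "e > 0" "e \<le> d" "e < d / (2 * real (length zs))"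
      using \<open>d > 0\<close> zs(1) by (auto simp: e_def divide_simps)
    have "\<exists>M'\<in>S. M' < M + e"
      using cInf_less_iff[OF _ bdd, of "M + e"] \<open>B \<in> S\<close> e(1) by (auto simp: M_def)
    then obtain M' ys where "ys \<noteq> []" "\<And>x. avg ys f x \<le> M'" "M' < M + e"
      unfolding S_def by blast
    then have ys: "ys \<noteq> []" "\<And>x. avg ys f x \<le> M + e"
      by (auto intro: order.trans less_imp_le)
    have "norm (avg ys f x - M) \<le> d" for x
    proof (rule ccontr)
      assume "\<not> norm (avg ys f x - M) \<le> d"
      with ys(2)[of x] e(1,2) have x: "avg ys f x \<le> M + e - d"
        by (auto simp: abs_if split: if_splits)
      have "avg ys f (t + u) \<le> avg ys f t + d / 2" if "u \<in> U" for t u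
      proof -
        have "avg ys f (u + t) - avg ys f t = avg ys (\<lambda>t. f (u + t) - f t) t"
          by (simp add: avg_diff avg_shift)
        also have "\<dots> \<le> d / 2"
          using U(3)[OF that] by (intro avg_le ys(1)) (smt (verit) add.commute real_norm_def)
        finally show ?thesis by (simp add: add.commute)
      qed
      from avg_spread[OF zs(2) this ys(2) x]
      have *: "avg zs (avg ys f) y \<le> M + e - d / (2 * real (length zs))" for y
        by simp
      have "M + e - d / (2 * real (length zs)) \<in> S"
        unfolding S_def mem_Collect_eq
      proof (intro exI conjI allI)
        show "list_sums zs ys \<noteq> []"
          using zs(1) ys(1) by (simp add: list_sums_eq_Nil)
      qed (use * in \<open>simp add: avg_avg\<close>)
      then have "M \<le> M + e - d / (2 * real (length zs))"
        unfolding M_def by (intro cInf_lower bdd)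
      with e show False by simp
    qed
    with ys(1) show "\<exists>ys. ys \<noteq> [] \<and> (\<forall>x. norm (avg ys f x - M) \<le> d)"
      by blast
  qed
  then show ?thesis by blast
qed

lemma is_mean_complex_ex:
  fixes f :: "'g \<Rightarrow> complex"
  assumes "continuous_on UNIV f"
  shows "\<exists>c. is_mean f c"
proof -
  obtain a where "is_mean (\<lambda>x. Re (f x)) a"
    using is_mean_real_ex[of "\<lambda>x. Re (f x)"] assms by (auto intro: continuous_intros)
  moreover obtain b where "is_mean (\<lambda>x. Im (f x)) b"
    using is_mean_real_ex[of "\<lambda>x. Im (f x)"] assms by (auto intro: continuous_intros)
  ultimately have "is_mean (\<lambda>x. complex_of_real (Re (f x)) + \<i> * complex_of_real (Im (f x)))
      (of_real a + \<i> * of_real b)"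
    by (intro is_mean_add is_mean_linear[of "\<lambda>x. \<i> * of_real x"] is_mean_linear[OF bounded_linear_of_real])
       (auto intro: bounded_linear_const_mult bounded_linear_of_real)
  then show ?thesis
    by (auto simp: complex_eq[symmetric])
qed

text \<open>
  The mean is faithful: \<open>avg_spread\<close>, applied to \<open>- f\<close> with the upper bound 0, gives an average of
  \<open>f\<close> that is bounded below by a positive constant.
\<close>

lemma is_mean_pos:
  fixes f :: "'g \<Rightarrow> real"
  assumes "continuous_on UNIV f" "is_mean f c" "\<And>x. f x \<ge> 0" "f x0 > 0"
  shows "c > 0"
proof -
  define d where "d = f x0"
  have d: "d > 0" "d / 2 > 0" using assms(4) by (simp_all add: d_def)
  obtain U where U: "open U" "0 \<in> U" "\<And>x u. u \<in> U \<Longrightarrow> norm (f (x + u) - f x) < d / 2"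
    using uniform_modulus[OF assms(1) d(2)] by metis
  obtain zs where zs: "zs \<noteq> []" "\<And>w. \<exists>z\<in>set zs. w + z \<in> U"
    using finite_translates_cover[OF U(1,2)] by blast
  have "- f (x + u) \<le> - f x + d / 2" if "u \<in> U" for x u
    using U(3)[OF that, of x] by (smt (verit) real_norm_def)
  then have "avg zs (\<lambda>x. - f x) x \<le> 0 - d / (2 * real (length zs))" for x
    using avg_spread[OF zs(2), of "\<lambda>x. - f x" d 0 x0 x] assms(3) by (simp add: d_def)
  moreover have "is_mean (avg zs (\<lambda>x. - f x)) (- c)"
    by (intro is_mean_avg zs(1) is_mean_linear[of uminus] assms(2) bounded_linear_minus bounded_linear_ident)
  ultimately have "- c \<le> - (d / (2 * real (length zs)))"
    using is_mean_le[of "avg zs (\<lambda>x. - f x)" "- c" "- (d / (2 * real (length zs)))"] by simp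
  moreover have "d / (2 * real (length zs)) > 0"
    using d(1) zs(1) by simp
  ultimately show ?thesis by simp
qed

end

section \<open>The invariant mean and convolution\<close>

definition mean :: "('g::ab_group_add \<Rightarrow> complex) \<Rightarrow> complex"
  where "mean f = (THE c. is_mean f c)"

definition conv :: "('g::ab_group_add \<Rightarrow> complex) \<Rightarrow> ('g \<Rightarrow> complex) \<Rightarrow> 'g \<Rightarrow> complex"
  where "conv f g x = mean (\<lambda>y. f (x - y) * g y)"

definition star :: "('g::ab_group_add \<Rightarrow> complex) \<Rightarrow> 'g \<Rightarrow> complex"
  where "star f x = cnj (f (- x))"

text \<open>
  The square of the norm in \<open>L\<^sup>2\<close>.
\<close>

definition sqnorm :: "('g::ab_group_add \<Rightarrow> complex) \<Rightarrow> real"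
  where "sqnorm f = Re (mean (\<lambda>x. f x * cnj (f x)))"

lemma mean_eqI: "is_mean f c \<Longrightarrow> mean f = c"
  unfolding mean_def using is_mean_unique by blast

lemma mean_const: "mean (\<lambda>x. c) = c"
  by (intro mean_eqI is_mean_const)

lemma conv_shift_left: "conv (\<lambda>x. f (a + x)) h = (\<lambda>x. conv f h (a + x))"
  by (simp add: conv_def fun_eq_iff add_diff_eq)

lemma continuous_app:
  "continuous_on UNIV f \<Longrightarrow> continuous_on S u \<Longrightarrow> continuous_on S (\<lambda>x. f (u x))"
  by (rule continuous_on_compose2) auto

lemma continuous_star: 
  fixes f :: "'g::topological_ab_group_add \<Rightarrow> complex"
  assumes "continuous_on UNIV f"
  shows "continuous_on UNIV (star f)"
  unfolding star_def[abs_def] by (intro continuous_intros continuous_app[OF assms])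

lemma continuous_section:
  assumes "continuous_on UNIV (\<lambda>(x, y). F x y)"
  shows "continuous_on UNIV (F x)" and "continuous_on UNIV (\<lambda>x. F x y)"
  using continuous_app[OF assms, of UNIV "\<lambda>y. (x, y)"] continuous_app[OF assms, of UNIV "\<lambda>x. (x, y)"]
  by (simp_all add: continuous_on_Pair)

context
  assumes compact_group: "compact (UNIV :: 'g::topological_ab_group_add set)"
begin

lemma is_mean_mean:
  fixes f :: "'g \<Rightarrow> complex"
  assumes "continuous_on UNIV f"
  shows "is_mean f (mean f)"
  using is_mean_complex_ex[OF compact_group assms] mean_eqI by metis

context
  fixes f :: "'g \<Rightarrow> complex"
  assumes f: "continuous_on UNIV f"
begin

lemma mean_cmult: "mean (\<lambda>x. c * f x) = c * mean f"
  by (intro mean_eqI is_mean_linear[of "(*) c"] is_mean_mean f bounded_linear_mult_right)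

lemma mean_cnj: "mean (\<lambda>x. cnj (f x)) = cnj (mean f)"
  by (intro mean_eqI is_mean_linear[of cnj] is_mean_mean f bounded_linear_cnj)

lemma mean_shift: "mean (\<lambda>x. f (a + x)) = mean f"
  by (intro mean_eqI is_mean_shift is_mean_mean f)

lemma mean_reflect: "mean (\<lambda>x. f (a - x)) = mean f"
  using is_mean_reflect[OF is_mean_shift[OF is_mean_mean[OF f], of a]]
  by (intro mean_eqI) simp

end

context
  fixes f g :: "'g \<Rightarrow> complex"
  assumes f: "continuous_on UNIV f" and g: "continuous_on UNIV g"
begin

lemma mean_add: "mean (\<lambda>x. f x + g x) = mean f + mean g"
  by (intro mean_eqI is_mean_add is_mean_mean f g)

lemma mean_diff: "mean (\<lambda>x. f x - g x) = mean f - mean g"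
proof -
  have "is_mean (\<lambda>x. f x + - g x) (mean f + - mean g)"
    by (intro is_mean_add is_mean_linear[of uminus] is_mean_mean f g
        bounded_linear_minus bounded_linear_ident)
  then show ?thesis
    by (intro mean_eqI) simp
qed

lemma norm_mean_diff_le:
  assumes "\<And>x. norm (f x - g x) \<le> e"
  shows "norm (mean f - mean g) \<le> e"
proof (rule field_le_epsilon)
  fix d :: real assume "d > 0"
  moreover have "is_mean (\<lambda>x. f x - g x) (mean f - mean g)"
    using is_mean_mean[of "\<lambda>x. f x - g x"] f g mean_diff by (simp add: continuous_intros)
  ultimately obtain ys where ys: "ys \<noteq> []"
    "\<And>x. norm (avg ys (\<lambda>x. f x - g x) x - (mean f - mean g)) \<le> d"
    unfolding is_mean_def by metis
  have "norm (avg ys (\<lambda>x. f x - g x) 0) \<le> e"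
    using norm_avg_diff_le[OF ys(1), of "\<lambda>x. f x - g x" 0 e 0] assms by simp
  with ys(2)[of 0] show "norm (mean f - mean g) \<le> e + d"
    by (smt (verit) norm_triangle_sub norm_minus_commute)
qed

end

lemma norm_mean_le:
  fixes f :: "'g \<Rightarrow> complex"
  assumes "continuous_on UNIV f" "\<And>x. norm (f x) \<le> e"
  shows "norm (mean f) \<le> e"
  using norm_mean_diff_le[of f "\<lambda>_. 0" e] assms by (simp add: mean_const)

lemma continuous_mean:
  fixes F :: "'x::topological_space \<Rightarrow> 'g \<Rightarrow> complex"
  assumes F: "continuous_on UNIV (\<lambda>(x, y). F x y)"
  shows "continuous_on UNIV (\<lambda>x. mean (F x))"
  unfolding continuous_on_def
proof (intro ballI tendstoI)
  fix x0 :: 'x and e :: real assume "e > 0"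
  then have "e / 2 > 0" by simp
  then obtain N where N: "open N" "x0 \<in> N" "\<And>x y. x \<in> N \<Longrightarrow> norm (F x y - F x0 y) < e / 2"
    using tube_uniform[OF compact_group F] by metis
  have "dist (mean (F x)) (mean (F x0)) < e" if "x \<in> N" for x
  proof -
    have "norm (mean (F x) - mean (F x0)) \<le> e / 2"
      using N(3)[OF that] by (intro norm_mean_diff_le continuous_section[OF F] less_imp_le)
    with \<open>e > 0\<close> show ?thesis by (simp add: dist_norm)
  qed
  with N(1,2) show "\<forall>\<^sub>F x in at x0 within UNIV. dist (mean (F x)) (mean (F x0)) < e"
    unfolding eventually_at_topological by blast
qed

text \<open>
  For finitely many functions a single average serves all of them, by composition as in
  \<open>common_avg\<close>.
\<close>

lemma uniform_avg_finite:
  fixes F :: "'x \<Rightarrow> 'g \<Rightarrow> complex"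
  assumes "finite Z" "\<And>x. continuous_on UNIV (F x)" "e > 0"
  shows "\<exists>ys. ys \<noteq> [] \<and> (\<forall>x\<in>Z. \<forall>y. norm (avg ys (F x) y - mean (F x)) \<le> e)"
  using assms(1)
proof induction
  case empty
  show ?case by (intro exI[of _ "[0]"]) simp
next
  case (insert z Z)
  then obtain ys where ys: "ys \<noteq> []" "\<And>x y. x \<in> Z \<Longrightarrow> norm (avg ys (F x) y - mean (F x)) \<le> e"
    by blast
  obtain zs where zs: "zs \<noteq> []" "\<And>y. norm (avg zs (F z) y - mean (F z)) \<le> e"
    using is_mean_mean[OF assms(2)] assms(3) unfolding is_mean_def by metis
  let ?ws = "list_sums ys zs"
  have "?ws \<noteq> []"
    using ys(1) zs(1) by (simp add: list_sums_eq_Nil)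
  moreover have "norm (avg ?ws (F x) y - mean (F x)) \<le> e" if "x \<in> Z" for x y
    using norm_avg_diff_le[OF zs(1) ys(2)[OF that]] by (simp add: avg_avg[symmetric] avg_commute[of ys zs])
  moreover have "norm (avg ?ws (F z) y - mean (F z)) \<le> e" for y
    using norm_avg_diff_le[OF ys(1) zs(2)] by (simp add: avg_avg[symmetric])
  ultimately show ?case by blast
qed

text \<open>
  A continuous family indexed by a compact space is uniformly close to finitely many of its members,
  so a single average serves the whole family.
\<close>

lemma uniform_avg:
  fixes F :: "'g \<Rightarrow> 'g \<Rightarrow> complex"
  assumes F: "continuous_on UNIV (\<lambda>(x, y). F x y)" and "e > 0"
  shows "\<exists>ys. ys \<noteq> [] \<and> (\<forall>x y. norm (avg ys (F x) y - mean (F x)) \<le> e)"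
proof -
  have e: "e / 3 > 0" using \<open>e > 0\<close> by simp
  have "\<exists>N. open N \<and> x0 \<in> N \<and> (\<forall>x\<in>N. \<forall>y. norm (F x y - F x0 y) < e / 3)" for x0
    using tube_uniform[OF compact_group F e, of x0] by metis
  then obtain N where N: "\<And>x. open (N x)" "\<And>x. x \<in> N x"
    "\<And>x0 x y. x \<in> N x0 \<Longrightarrow> norm (F x y - F x0 y) < e / 3" by metis
  have cover: "UNIV \<subseteq> (\<Union>x\<in>UNIV. N x)" using N(2) by blast
  obtain Z where Z: "finite Z" "UNIV \<subseteq> (\<Union>z\<in>Z. N z)"
    using compactE_image[OF compact_group N(1) cover] by metis
  obtain ys where ys: "ys \<noteq> []" "\<And>z y. z \<in> Z \<Longrightarrow> norm (avg ys (F z) y - mean (F z)) \<le> e / 3"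
    using uniform_avg_finite[of Z F, OF Z(1) continuous_section(1)[OF F] e] by metis
  have "norm (avg ys (F x) y - mean (F x)) \<le> e" for x y
  proof -
    obtain z where z: "z \<in> Z" "x \<in> N z" using Z(2) by blast
    have d: "norm (F x y - F z y) \<le> e / 3" for y
      using N(3)[OF z(2)] by (rule less_imp_le)
    have "norm (avg ys (\<lambda>y. F x y - F z y) y) \<le> e / 3"
      using norm_avg_diff_le[OF ys(1), of "\<lambda>y. F x y - F z y" 0 "e / 3" y] d by simp
    then have "norm (avg ys (F x) y - avg ys (F z) y) \<le> e / 3"
      by (simp add: avg_diff)
    moreover have "norm (mean (F x) - mean (F z)) \<le> e / 3"
      by (intro norm_mean_diff_le continuous_section[OF F] d)
    moreover note ys(2)[OF z(1), of y]
    moreover have "norm (avg ys (F x) y - mean (F x)) \<le> norm (avg ys (F x) y - avg ys (F z) y)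
        + norm (avg ys (F z) y - mean (F z)) + norm (mean (F x) - mean (F z))"
      using norm_triangle_ineq4[of "avg ys (F x) y - avg ys (F z) y + (avg ys (F z) y - mean (F z))"
          "mean (F x) - mean (F z)"]
        norm_triangle_ineq[of "avg ys (F x) y - avg ys (F z) y" "avg ys (F z) y - mean (F z)"]
      by simp
    ultimately show ?thesis
      by linarith
  qed
  with ys(1) show ?thesis by blast
qed

text \<open>
  Fubini's theorem. Up to a uniform error the inner mean is one fixed finite average by
  \<open>uniform_avg\<close>, and means commute with finite sums.
\<close>

lemma mean_swap:
  fixes F :: "'g \<Rightarrow> 'g \<Rightarrow> complex"
  assumes F: "continuous_on UNIV (\<lambda>(x, y). F x y)"
  shows "mean (\<lambda>x. mean (\<lambda>y. F x y)) = mean (\<lambda>y. mean (\<lambda>x. F x y))"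
proof -
  define H where "H y = mean (\<lambda>x. F x y)" for y
  have "continuous_on UNIV (\<lambda>(y, x). F x y)"
    using continuous_app[OF F, of UNIV "\<lambda>(y, x). (x, y)"]
    by (simp add: case_prod_beta continuous_intros)
  then have H: "continuous_on UNIV H"
    unfolding H_def by (rule continuous_mean)
  have "norm (mean (\<lambda>x. mean (F x)) - mean H) \<le> e" if "e > 0" for e
  proof -
    have e: "e / 2 > 0" using that by simp
    obtain ys where ys: "ys \<noteq> []" "\<And>x y. norm (avg ys (F x) y - mean (F x)) \<le> e / 2"
      using uniform_avg[OF F e] by metis
    obtain zs where zs: "zs \<noteq> []" "\<And>y. norm (avg zs H y - mean H) \<le> e / 2"
      using is_mean_mean[OF H] e unfolding is_mean_def by metis
    define ws where "ws = list_sums ys zs"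
    have 1: "norm (avg ws (F x) y - mean (F x)) \<le> e / 2" for x y
      using norm_avg_diff_le[OF zs(1) ys(2)]
      by (simp add: ws_def avg_avg[symmetric] avg_commute[of ys zs])
    have 2: "norm (avg ws H 0 - mean H) \<le> e / 2"
      using norm_avg_diff_le[OF ys(1) zs(2)] by (simp add: ws_def avg_avg[symmetric])
    have "is_mean (\<lambda>x. \<Sum>w\<leftarrow>ws. F x w) (\<Sum>w\<leftarrow>ws. H w)"
      by (induction ws) (auto simp: H_def intro!: is_mean_const is_mean_add is_mean_mean continuous_section[OF F])
    then have avg_H: "is_mean (\<lambda>x. avg ws (F x) 0) (avg ws H 0)"
      unfolding avg_def add_0 by (rule is_mean_linear[OF bounded_linear_scaleR_right])
    have "continuous_on UNIV (\<lambda>x. \<Sum>w\<leftarrow>ws. F x w)"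
      by (induction ws) (auto intro!: continuous_intros continuous_section[OF F])
    then have "continuous_on UNIV (\<lambda>x. avg ws (F x) 0)"
      unfolding avg_def by (auto intro: continuous_intros)
    then have "norm (mean (\<lambda>x. avg ws (F x) 0) - mean (\<lambda>x. mean (F x))) \<le> e / 2"
      by (intro norm_mean_diff_le continuous_mean F 1)
    then have "norm (avg ws H 0 - mean (\<lambda>x. mean (F x))) \<le> e / 2"
      by (simp add: mean_eqI[OF avg_H])
    with 2 show ?thesis
      using norm_triangle_ineq4[of "avg ws H 0 - mean H" "avg ws H 0 - mean (\<lambda>x. mean (F x))"]
      by simp
  qed
  then have "norm (mean (\<lambda>x. mean (F x)) - mean H) \<le> 0"
    using field_le_epsilon[of "norm (mean (\<lambda>x. mean (F x)) - mean H)" 0] by simp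
  then show ?thesis
    by (simp add: H_def[abs_def])
qed

lemma continuous_conv:
  fixes f g :: "'g \<Rightarrow> complex"
  assumes "continuous_on UNIV f" "continuous_on UNIV g"
  shows "continuous_on UNIV (conv f g)"
  unfolding conv_def[abs_def]
  by (rule continuous_mean, unfold case_prod_beta)
     (intro continuous_intros continuous_app[OF assms(1)] continuous_app[OF assms(2)])

lemma conv_commute:
  fixes f g :: "'g \<Rightarrow> complex"
  assumes "continuous_on UNIV f" "continuous_on UNIV g"
  shows "conv f g = conv g f"
proof
  fix x
  have "mean (\<lambda>y. f (x - (x - y)) * g (x - y)) = mean (\<lambda>y. f (x - y) * g y)"
    by (rule mean_reflect[of "\<lambda>y. f (x - y) * g y"])
       (intro continuous_intros continuous_app[OF assms(1)] continuous_app[OF assms(2)])+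
  then show "conv f g x = conv g f x"
    by (simp add: conv_def mult.commute)
qed

lemma conv_assoc:
  fixes f g h :: "'g \<Rightarrow> complex"
  assumes f: "continuous_on UNIV f" and g: "continuous_on UNIV g" and h: "continuous_on UNIV h"
  shows "conv (conv f g) h = conv f (conv g h)"
proof
  fix x
  note cont = continuous_intros continuous_app[OF f] continuous_app[OF g] continuous_app[OF h]
  have "conv (conv f g) h x = mean (\<lambda>z. mean (\<lambda>y. f (x - z - y) * g y) * h z)"
    by (simp add: conv_def)
  also have "\<dots> = mean (\<lambda>z. mean (\<lambda>y. f (x - y) * g (y - z) * h z))"
  proof -
    have "mean (\<lambda>y. f (x - z - y) * g y) * h z = mean (\<lambda>y. f (x - y) * g (y - z) * h z)" for z
    proof -
      have "mean (\<lambda>y. f (x - z - (- z + y)) * g (- z + y)) = mean (\<lambda>y. f (x - z - y) * g y)"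
        by (rule mean_shift[of "\<lambda>y. f (x - z - y) * g y"]) (intro cont)+
      moreover have "mean (\<lambda>y. h z * (f (x - y) * g (y - z))) = h z * mean (\<lambda>y. f (x - y) * g (y - z))"
        by (rule mean_cmult) (intro cont)+
      ultimately show ?thesis
        by (simp add: mult.commute mult.left_commute)
    qed
    then show ?thesis by simp
  qed
  also have "\<dots> = mean (\<lambda>y. mean (\<lambda>z. f (x - y) * g (y - z) * h z))"
    by (rule mean_swap, unfold case_prod_beta) (intro cont)
  also have "\<dots> = mean (\<lambda>y. f (x - y) * mean (\<lambda>z. g (y - z) * h z))"
  proof -
    have "mean (\<lambda>z. f (x - y) * (g (y - z) * h z)) = f (x - y) * mean (\<lambda>z. g (y - z) * h z)" for y
      by (rule mean_cmult) (intro cont)+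
    then show ?thesis by (simp add: mult.assoc)
  qed
  also have "\<dots> = conv f (conv g h) x"
    by (simp add: conv_def)
  finally show "conv (conv f g) h x = conv f (conv g h) x" .
qed

lemma conv_add_left:
  fixes f g h :: "'g \<Rightarrow> complex"
  assumes "continuous_on UNIV f" "continuous_on UNIV g" "continuous_on UNIV h"
  shows "conv (\<lambda>x. f x + g x) h = (\<lambda>x. conv f h x + conv g h x)"
  unfolding conv_def distrib_right
  by (intro ext mean_add continuous_intros continuous_app[OF assms(1)] continuous_app[OF assms(2)] continuous_app[OF assms(3)])

lemma conv_diff_left:
  fixes f g h :: "'g \<Rightarrow> complex"
  assumes "continuous_on UNIV f" "continuous_on UNIV g" "continuous_on UNIV h"
  shows "conv (\<lambda>x. f x - g x) h = (\<lambda>x. conv f h x - conv g h x)"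
  unfolding conv_def left_diff_distrib
  by (intro ext mean_diff continuous_intros continuous_app[OF assms(1)] continuous_app[OF assms(2)] continuous_app[OF assms(3)])

lemma conv_cmult_left:
  fixes f h :: "'g \<Rightarrow> complex"
  assumes "continuous_on UNIV f" "continuous_on UNIV h"
  shows "conv (\<lambda>x. c * f x) h = (\<lambda>x. c * conv f h x)"
  unfolding conv_def mult.assoc
  by (intro ext mean_cmult continuous_intros continuous_app[OF assms(1)] continuous_app[OF assms(2)])

lemma star_conv:
  fixes f g :: "'g \<Rightarrow> complex"
  assumes f: "continuous_on UNIV f" and g: "continuous_on UNIV g"
  shows "star (conv f g) = conv (star f) (star g)"
proof
  fix x
  note cont = continuous_intros continuous_app[OF f] continuous_app[OF g]
  have "star (conv f g) x = mean (\<lambda>y. cnj (f (- x - y) * g y))"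
    unfolding star_def conv_def by (rule mean_cnj[symmetric]) (intro cont)+
  also have "\<dots> = mean (\<lambda>y. cnj (f (- x - (0 - y)) * g (0 - y)))"
    by (rule mean_reflect[symmetric]) (intro cont)+
  also have "\<dots> = conv (star f) (star g) x"
    by (simp add: conv_def star_def)
  finally show "star (conv f g) x = conv (star f) (star g) x" .
qed

text \<open>
  Evaluation at 0 turns the product and the involution of the convolution algebra into the inner
  product of \<open>L\<^sup>2\<close>.
\<close>

lemma conv_star_zero:
  fixes f g :: "'g \<Rightarrow> complex"
  assumes f: "continuous_on UNIV f" and g: "continuous_on UNIV g"
  shows "conv f (star g) 0 = mean (\<lambda>x. f x * cnj (g x))"
proof -
  have "mean (\<lambda>y. f (0 - y) * cnj (g (0 - y))) = mean (\<lambda>y. f y * cnj (g y))"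
    by (rule mean_reflect) (intro continuous_intros continuous_app[OF f] continuous_app[OF g])+
  then show ?thesis
    by (simp add: conv_def star_def)
qed

context
  fixes f :: "'g \<Rightarrow> complex"
  assumes f: "continuous_on UNIV f"
begin

lemma is_mean_sqnorm: "is_mean (\<lambda>x. (norm (f x))\<^sup>2) (sqnorm f)"
proof -
  have "is_mean (\<lambda>x. Re (f x * cnj (f x))) (sqnorm f)"
    unfolding sqnorm_def
    by (intro is_mean_linear[of Re] bounded_linear_Re is_mean_mean continuous_intros f)
  then show ?thesis
    by (simp add: complex_mult_cnj cmod_power2)
qed

lemma sqnorm_pos: "f x \<noteq> 0 \<Longrightarrow> sqnorm f > 0"
  by (rule is_mean_pos[OF compact_group _ is_mean_sqnorm, of x]) (auto intro!: continuous_intros f)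

lemma sqnorm_zero: "sqnorm f \<le> 0 \<Longrightarrow> f = (\<lambda>x. 0)"
  using sqnorm_pos by fastforce

lemma sqnorm_nonneg: "sqnorm f \<ge> 0"
  using is_mean_le[OF is_mean_linear[OF bounded_linear_minus[OF bounded_linear_ident] is_mean_sqnorm], of 0]
  by simp

lemma sqnorm_le: "(\<And>x. (norm (f x))\<^sup>2 \<le> B) \<Longrightarrow> sqnorm f \<le> B"
  by (rule is_mean_le[OF is_mean_sqnorm])

lemma mean_mult_cnj: "mean (\<lambda>x. f x * cnj (f x)) = of_real (sqnorm f)"
proof -
  have "is_mean (\<lambda>x. complex_of_real ((norm (f x))\<^sup>2)) (of_real (sqnorm f))"
    by (intro is_mean_linear[OF bounded_linear_of_real] is_mean_sqnorm)
  then show ?thesis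
    by (intro mean_eqI) (simp flip: complex_norm_square)
qed

end

lemma conv_star_self:
  fixes f :: "'g \<Rightarrow> complex"
  assumes "continuous_on UNIV f"
  shows "conv f (star f) 0 = of_real (sqnorm f)"
  by (simp add: conv_star_zero mean_mult_cnj assms)

text \<open>
  With \<open>d\<close> the mean of \<open>\<bar>f g\<bar>\<close>, the mean of \<open>(t \<bar>f\<bar> - \<bar>g\<bar>)\<^sup>2\<close> is a quadratic polynomial
  in \<open>t\<close> without negative values, and the claim is that its discriminant is not positive.
\<close>

lemma Cauchy_Schwarz_mean:
  fixes f g :: "'g \<Rightarrow> complex"
  assumes f: "continuous_on UNIV f" and g: "continuous_on UNIV g"
  shows "(norm (mean (\<lambda>x. f x * g x)))\<^sup>2 \<le> sqnorm f * sqnorm g"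
proof -
  have "continuous_on UNIV (\<lambda>x. norm (f x * g x))"
    by (intro continuous_intros f g)
  then obtain d where d: "is_mean (\<lambda>x. norm (f x * g x)) d"
    using is_mean_real_ex[OF compact_group] by blast
  have "is_mean (\<lambda>x. f x * g x) (mean (\<lambda>x. f x * g x))"
    by (intro is_mean_mean continuous_intros f g)
  from norm_is_mean_le[OF this d] have *: "norm (mean (\<lambda>x. f x * g x)) \<le> d" .
  have quadratic: "- t\<^sup>2 * sqnorm f + 2 * t * d + (- 1) * sqnorm g \<le> 0" for t
  proof (rule is_mean_le)
    show "is_mean (\<lambda>x. - t\<^sup>2 * (norm (f x))\<^sup>2 + 2 * t * norm (f x * g x) + (- 1) * (norm (g x))\<^sup>2)
      (- t\<^sup>2 * sqnorm f + 2 * t * d + (- 1) * sqnorm g)"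
      by (intro is_mean_add is_mean_linear[OF bounded_linear_mult_right] is_mean_sqnorm f g d)
    show "- t\<^sup>2 * (norm (f x))\<^sup>2 + 2 * t * norm (f x * g x) + (- 1) * (norm (g x))\<^sup>2 \<le> 0" for x
      using zero_le_power2[of "t * norm (f x) - norm (g x)"]
      by (simp add: power2_diff norm_mult power_mult_distrib algebra_simps)
  qed
  have "d\<^sup>2 \<le> sqnorm f * sqnorm g"
  proof (cases "sqnorm f > 0")
    case True
    then show ?thesis
      using quadratic[of "d / sqnorm f"] by (simp add: field_simps power2_eq_square)
  next
    case False
    then have "f = (\<lambda>x. 0)"
      using sqnorm_zero[OF f] by simp
    then have "d = 0"
      using is_mean_unique[OF d] is_mean_const[of "0::real"] by simp
    then show ?thesis
      using sqnorm_nonneg[OF f] sqnorm_nonneg[OF g] by simp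
  qed
  with * show ?thesis
    by (meson norm_ge_zero order_trans power_mono)
qed

text \<open>
  Convolution improves estimates in \<open>L\<^sup>2\<close> to uniform ones. This is what replaces the compactness of
  the convolution operator in the power iteration below.
\<close>

lemma norm_conv_le:
  fixes f g :: "'g \<Rightarrow> complex"
  assumes f: "continuous_on UNIV f" and g: "continuous_on UNIV g"
  shows "(norm (conv f g x))\<^sup>2 \<le> sqnorm f * sqnorm g"
proof -
  have cont: "continuous_on UNIV (\<lambda>y. f (x - y))"
    by (intro continuous_intros continuous_app[OF f])
  have "sqnorm (\<lambda>y. f (x - y)) = sqnorm f"
    unfolding sqnorm_def
    by (subst mean_reflect[of "\<lambda>y. f y * cnj (f y)"]) (auto intro!: continuous_intros f)
  then show ?thesis
    using Cauchy_Schwarz_mean[OF cont g] by (simp add: conv_def)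
qed

lemma norm_conv_sup_le:
  fixes f g :: "'g \<Rightarrow> complex"
  assumes f: "continuous_on UNIV f" and g: "continuous_on UNIV g"
    and "\<And>x. norm (f x) \<le> A" "\<And>x. norm (g x) \<le> B"
  shows "norm (conv f g x) \<le> A * B"
  unfolding conv_def
proof (rule norm_mean_le)
  show "continuous_on UNIV (\<lambda>y. f (x - y) * g y)"
    by (intro continuous_intros continuous_app[OF f] g)
  have "A \<ge> 0" using order_trans[OF norm_ge_zero assms(3)] .
  then show "norm (f (x - y) * g y) \<le> A * B" for y
    unfolding norm_mult by (intro mult_mono assms) auto
qed

end

section \<open>Minimal idempotents and the separation of points by characters\<close>

lemma star_star: "star (star f) = f"
  by (simp add: star_def fun_eq_iff)

primrec conv_power :: "('g::ab_group_add \<Rightarrow> complex) \<Rightarrow> nat \<Rightarrow> 'g \<Rightarrow> complex" where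
  "conv_power r 0 = r"
| "conv_power r (Suc n) = conv r (conv_power r n)"

definition hermitian_idempotent :: "('g::topological_ab_group_add \<Rightarrow> complex) \<Rightarrow> bool"
  where "hermitian_idempotent q \<longleftrightarrow>
    continuous_on UNIV q \<and> star q = q \<and> conv q q = q \<and> q \<noteq> (\<lambda>x. 0)"

text \<open>
  The numerical half of the power iteration, where \<open>c n\<close> is the squared norm of the convolution power
  \<open>r^(n + 1)\<close>. By log-convexity the ratios \<open>c (n + 1) / c n\<close> increase to some \<open>L\<close>, so
  \<open>c n / L ^ (n + 1)\<close> decreases. Its limit is not 0 because of submultiplicativity, which keeps
  \<open>c n\<close> from falling below \<open>L ^ (n + 1)\<close>.
\<close>

lemma log_convex_power_growth:
  fixes c :: "nat \<Rightarrow> real"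
  assumes pos: "\<And>n. c n > 0"
    and convex: "\<And>n. (c (Suc n))\<^sup>2 \<le> c n * c (Suc (Suc n))"
    and submult: "\<And>m n. c (Suc (m + n)) \<le> c m * c n"
  obtains L D where "L > 0" "D \<ge> 1" "(\<lambda>n. c n / L ^ Suc n) \<longlonglongrightarrow> D"
proof -
  define \<rho> where "\<rho> n = c (Suc n) / c n" for n
  have "incseq \<rho>"
    using convex pos by (intro incseq_SucI) (simp add: \<rho>_def divide_simps power2_eq_square mult.commute)
  moreover have bound: "\<rho> n \<le> c 0" for n
    using submult[of 0 n] pos[of n] by (simp add: \<rho>_def field_simps)
  ultimately obtain L where L: "\<rho> \<longlonglongrightarrow> L" "\<And>n. \<rho> n \<le> L"
    using incseq_convergent[of \<rho> "c 0"] by blast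
  have "\<rho> 0 > 0"
    using pos by (simp add: \<rho>_def)
  then have "L > 0"
    using L(2)[of 0] by simp
  have grow: "\<rho> k ^ j * c k \<le> c (k + j)" for k j
  proof (induction j)
    case (Suc j)
    have "\<rho> k ^ Suc j * c k = \<rho> k * (\<rho> k ^ j * c k)"
      by simp
    also have "\<dots> \<le> \<rho> (k + j) * c (k + j)"
      using pos Suc \<open>incseq \<rho>\<close>
      by (intro mult_mono) (auto simp: \<rho>_def incseq_def intro!: less_imp_le)
    also have "\<dots> = c (k + Suc j)"
      using pos[of "k + j"] by (simp add: \<rho>_def)
    finally show ?case .
  qed simp
  \<comment> \<open>The sequence grows from \<open>k\<close> to \<open>k + n + 1\<close> by a factor between \<open>\<rho> k ^ (n + 1)\<close> and \<open>c n\<close>.\<close>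
  have "\<rho> k ^ Suc n \<le> c n" for k n
  proof -
    have "\<rho> k ^ Suc n * c k \<le> c k * c n"
      using grow[of k "Suc n"] submult[of k n] by simp
    then show ?thesis
      using pos[of k] by (simp add: mult.commute)
  qed
  then have "L ^ Suc n \<le> c n" for n
    using LIMSEQ_le_const2[OF tendsto_power[OF L(1)]] by blast
  then have lower: "1 \<le> c n / L ^ Suc n" for n
    using \<open>L > 0\<close> by simp
  have "c (Suc n) \<le> L * c n" for n
    using L(2)[of n] pos[of n] by (simp add: \<rho>_def field_simps)
  then have "decseq (\<lambda>n. c n / L ^ Suc n)"
    using \<open>L > 0\<close> by (intro decseq_SucI) (simp add: field_simps)
  then obtain D where "(\<lambda>n. c n / L ^ Suc n) \<longlonglongrightarrow> D"
    using lower decseq_convergent[of "\<lambda>n. c n / L ^ Suc n" 1] by blast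
  moreover from this have "D \<ge> 1"
    using lower by (intro LIMSEQ_le_const) auto
  ultimately show thesis
    using that \<open>L > 0\<close> by blast
qed

context
  assumes compact_group: "compact (UNIV :: 'g::topological_ab_group_add set)"
begin

lemmas continuous_convolution =
  continuous_conv[OF compact_group] continuous_star continuous_shift

lemma conv_add_right:
  fixes f g h :: "'g \<Rightarrow> complex"
  assumes "continuous_on UNIV f" "continuous_on UNIV g" "continuous_on UNIV h"
  shows "conv h (\<lambda>x. f x + g x) = (\<lambda>x. conv h f x + conv h g x)"
  using conv_add_left[OF compact_group assms] assms
  by (simp add: conv_commute[OF compact_group, of h] continuous_intros)

lemma conv_diff_right:
  fixes f g h :: "'g \<Rightarrow> complex"
  assumes "continuous_on UNIV f" "continuous_on UNIV g" "continuous_on UNIV h"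
  shows "conv h (\<lambda>x. f x - g x) = (\<lambda>x. conv h f x - conv h g x)"
  using conv_diff_left[OF compact_group assms] assms
  by (simp add: conv_commute[OF compact_group, of h] continuous_intros)

lemma conv_cmult_right:
  fixes f h :: "'g \<Rightarrow> complex"
  assumes "continuous_on UNIV f" "continuous_on UNIV h"
  shows "conv h (\<lambda>x. c * f x) = (\<lambda>x. c * conv h f x)"
  using conv_cmult_left[OF compact_group assms] assms
  by (simp add: conv_commute[OF compact_group, of h] continuous_intros)

lemma conv_tendsto:
  fixes h q :: "'g \<Rightarrow> complex" and f :: "nat \<Rightarrow> 'g \<Rightarrow> complex"
  assumes h: "continuous_on UNIV h" and f: "\<And>n. continuous_on UNIV (f n)"
    and q: "continuous_on UNIV q" and lim: "uniform_limit UNIV f q sequentially"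
  shows "(\<lambda>n. conv h (f n) x) \<longlonglongrightarrow> conv h q x"
proof (rule tendstoI)
  fix e :: real assume "e > 0"
  obtain B where B: "B > 0" "\<And>x. norm (h x) \<le> B"
    using continuous_bounded[OF compact_group h] by blast
  have "e / (2 * B) > 0" using \<open>e > 0\<close> B(1) by simp
  from uniform_limitD[OF lim this]
  show "\<forall>\<^sub>F n in sequentially. dist (conv h (f n) x) (conv h q x) < e"
  proof eventually_elim
    case (elim n)
    have "norm (conv h (\<lambda>x. f n x - q x) x) \<le> B * (e / (2 * B))"
      using elim B(2)
      by (intro norm_conv_sup_le[OF compact_group] continuous_intros h f q)
         (auto simp: dist_norm intro: less_imp_le)
    also have "\<dots> < e"
      using B(1) \<open>e > 0\<close> by simp
    finally show ?case
      by (simp add: conv_diff_right h f q dist_norm)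
  qed
qed

text \<open>
  Power iteration. The powers of \<open>r * r\<close>, rescaled by the powers of its largest eigenvalue \<open>L\<close>,
  converge to the projection \<open>q\<close> onto the corresponding eigenspace. No spectral theory is involved:
  by the choice of \<open>L\<close> in \<open>log_convex_power_growth\<close> the inner products of two rescaled powers, which
  depend only on the sum of the exponents, converge to one and the same \<open>D \<ge> 1\<close>. So the rescaled
  powers form a Cauchy sequence in \<open>L\<^sup>2\<close> whose limit is not 0, and one further convolution
  makes the convergence uniform.
\<close>

lemma power_method:
  fixes r :: "'g \<Rightarrow> complex"
  assumes r: "continuous_on UNIV r" and herm: "star r = r" and nz: "r \<noteq> (\<lambda>x. 0)"
  obtains L q where "L > 0" "hermitian_idempotent q" "conv (conv r r) q = (\<lambda>x. of_real L * q x)"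
proof -
  define R where "R = conv_power r"
  have R[simp]: "R 0 = r" "R (Suc n) = conv r (R n)" for n
    by (simp_all add: R_def)
  have R_cont: "continuous_on UNIV (R n)" for n
    by (induction n) (auto intro: r continuous_convolution)
  have R_star: "star (R n) = R n" for n
    by (induction n) (auto simp: herm star_conv[OF compact_group r R_cont])
  have R_conv: "conv (R m) (R n) = R (Suc (m + n))" for m n
    by (induction m) (simp_all add: conv_assoc[OF compact_group r R_cont R_cont])
  define c where "c n = sqnorm (R n)" for n
  have R_zero: "R (Suc (2 * n)) 0 = of_real (c n)" for n
    using conv_star_self[OF compact_group R_cont, of n]
    by (simp add: R_star R_conv c_def mult_2 del: R)
  \<comment> \<open>The inner product of \<open>R n\<close> and \<open>R (n + 2)\<close> is the squared norm of the power between them.\<close>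
  have convex: "(c (Suc n))\<^sup>2 \<le> c n * c (Suc (Suc n))" for n
  proof -
    have "Suc (n + Suc (Suc n)) = Suc (2 * Suc n)" by simp
    then have "conv (R n) (R (Suc (Suc n))) 0 = of_real (c (Suc n))"
      by (metis R_conv R_zero)
    then show ?thesis
      using norm_conv_le[OF compact_group R_cont R_cont, of n "Suc (Suc n)" 0] by (simp add: c_def)
  qed
  have submult: "c (Suc (m + n)) \<le> c m * c n" for m n
    using sqnorm_le[OF compact_group R_cont, of "Suc (m + n)"]
      norm_conv_le[OF compact_group R_cont R_cont, of m n]
    by (simp add: c_def R_conv del: R)
  have "c n > 0 \<and> c (Suc n) > 0" for n
  proof (induction n)
    case 0
    have 0: "c 0 > 0"
      using sqnorm_pos[OF compact_group r] nz by (auto simp: c_def)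
    have "c (Suc 0) > 0"
    proof (rule ccontr)
      assume "\<not> c (Suc 0) > 0"
      then have "R (Suc 0) = (\<lambda>x. 0)"
        unfolding c_def by (intro sqnorm_zero[OF compact_group R_cont]) simp
      with R_zero[of 0] 0 show False by simp
    qed
    with 0 show ?case by simp
  next
    case (Suc n)
    then have "0 < (c (Suc n))\<^sup>2" by simp
    then have "0 < c n * c (Suc (Suc n))"
      using convex[of n] by linarith
    with Suc show ?case by (simp add: zero_less_mult_iff)
  qed
  then have "c n > 0" for n by blast
  from log_convex_power_growth[of c, OF this convex submult]
  obtain L D where L: "L > 0" "D \<ge> 1" and D: "(\<lambda>n. c n / L ^ Suc n) \<longlonglongrightarrow> D" by blast
  \<comment> \<open>Only the powers of \<open>r * r\<close> are used: \<open>r\<close> itself may have the eigenvalue of largest modulus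
      with both signs, and then its rescaled powers oscillate.\<close>
  define S where "S n x = of_real (1 / L ^ Suc n) * R (Suc (2 * n)) x" for n x
  have S_cont: "continuous_on UNIV (S n)" for n
    unfolding S_def[abs_def] by (intro continuous_intros R_cont)
  have S_star: "star (S n) = S n" for n
    using R_star[of "Suc (2 * n)"] by (simp add: S_def star_def fun_eq_iff del: R)
  have S_conv: "conv (S m) (S n) = S (Suc (m + n))" for m n
  proof -
    have "conv (\<lambda>x. a * R (Suc (2 * m)) x) (\<lambda>x. b * R (Suc (2 * n)) x) =
        (\<lambda>x. a * (b * R (Suc (2 * Suc (m + n))) x))" for a b
    proof -
      have "conv (R (Suc (2 * m))) (R (Suc (2 * n))) = R (Suc (2 * Suc (m + n)))"
        by (simp add: R_conv del: R)
      moreover have "continuous_on UNIV (\<lambda>x. b * R (Suc (2 * n)) x)"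
        by (intro continuous_intros R_cont)
      ultimately show ?thesis
        by (simp add: conv_cmult_left[OF compact_group] conv_cmult_right R_cont del: R)
    qed
    then show ?thesis
      unfolding S_def[abs_def] using L(1) by (simp only: power_add) (simp add: power_add fun_eq_iff del: R)
  qed
  have S_zero: "S n 0 = of_real (c n / L ^ Suc n)" for n
    by (simp add: S_def R_zero del: R)
  have S_dist: "sqnorm (\<lambda>x. S n x - S m x) =
      c (Suc (n + n)) / L ^ Suc (Suc (n + n)) - 2 * (c (Suc (n + m)) / L ^ Suc (Suc (n + m)))
      + c (Suc (m + m)) / L ^ Suc (Suc (m + m))" for n m
  proof -
    let ?h = "\<lambda>x. S n x - S m x"
    have h: "continuous_on UNIV ?h"
      by (intro continuous_intros S_cont)
    have "star ?h = ?h"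
      using S_star[of n] S_star[of m] by (simp add: star_def fun_eq_iff)
    then have "of_real (sqnorm ?h) = conv ?h ?h 0"
      using conv_star_self[OF compact_group h] by simp
    also have "\<dots> = S (Suc (n + n)) 0 - 2 * S (Suc (n + m)) 0 + S (Suc (m + m)) 0"
      by (simp add: conv_diff_left[OF compact_group] conv_diff_right S_cont h S_conv add.commute)
    finally have "complex_of_real (sqnorm ?h) = of_real (c (Suc (n + n)) / L ^ Suc (Suc (n + n))
        - 2 * (c (Suc (n + m)) / L ^ Suc (Suc (n + m))) + c (Suc (m + m)) / L ^ Suc (Suc (m + m)))"
      by (simp only: S_zero of_real_add of_real_diff of_real_mult of_real_numeral)
    then show ?thesis
      by (simp only: of_real_eq_iff)
  qed
  have "uniformly_Cauchy_on UNIV (\<lambda>n. S (Suc n))"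
  proof (rule uniformly_Cauchy_onI)
    fix e :: real assume "e > 0"
    define K where "K = sqnorm (S 0) + 1"
    have "K > 0" using sqnorm_nonneg[OF compact_group S_cont, of 0] by (simp add: K_def)
    define d where "d = e\<^sup>2 / (4 * K)"
    have "d > 0" using \<open>e > 0\<close> \<open>K > 0\<close> by (simp add: d_def)
    then obtain M where M: "\<And>n. n \<ge> M \<Longrightarrow> \<bar>c n / L ^ Suc n - D\<bar> < d"
      using LIMSEQ_D[OF D] by (metis real_norm_def)
    have "dist (S (Suc m) x) (S (Suc n) x) < e" if "m \<ge> M" "n \<ge> M" for m n x
    proof -
      let ?h = "\<lambda>x. S m x - S n x"
      have "sqnorm ?h < 4 * d"
        using M[of "Suc (m + m)"] M[of "Suc (m + n)"] M[of "Suc (n + n)"] that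
        unfolding S_dist by linarith
      have "(norm (conv (S 0) ?h x))\<^sup>2 \<le> sqnorm (S 0) * sqnorm ?h"
        by (intro norm_conv_le[OF compact_group] continuous_intros S_cont)
      also have "\<dots> \<le> K * sqnorm ?h"
        by (intro mult_right_mono sqnorm_nonneg[OF compact_group] continuous_intros S_cont)
           (simp add: K_def)
      also have "\<dots> < K * (4 * d)"
        using \<open>sqnorm ?h < 4 * d\<close> \<open>K > 0\<close> by simp
      also have "\<dots> = e\<^sup>2"
        using \<open>K > 0\<close> by (simp add: d_def)
      finally have "norm (conv (S 0) ?h x) < e"
        using \<open>e > 0\<close> by (simp add: power_less_imp_less_base)
      then show ?thesis
        by (simp add: conv_diff_right S_cont S_conv dist_norm)
    qed
    then show "\<exists>M. \<forall>x\<in>UNIV. \<forall>m\<ge>M. \<forall>n\<ge>M. dist (S (Suc m) x) (S (Suc n) x) < e"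
      by blast
  qed
  then obtain q where q: "uniform_limit UNIV (\<lambda>n. S (Suc n)) q sequentially"
    using Cauchy_uniformly_convergent uniformly_convergent_on_def by blast
  have q_cont: "continuous_on UNIV q"
    by (rule uniform_limit_theorem[OF always_eventually q]) (simp_all add: S_cont)
  have S_tendsto: "(\<lambda>n. S (Suc n) x) \<longlonglongrightarrow> q x" for x
    using tendsto_uniform_limitI[OF q] by blast
  have Sq: "conv (S m) q = q" for m
  proof
    fix x
    have "(\<lambda>n. conv (S m) (S (Suc n)) x) \<longlonglongrightarrow> conv (S m) q x"
      by (rule conv_tendsto[OF S_cont S_cont q_cont q])
    moreover have "(\<lambda>n. conv (S m) (S (Suc n)) x) \<longlonglongrightarrow> q x"
      using LIMSEQ_ignore_initial_segment[OF S_tendsto[of x], of "Suc m"]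
      by (simp add: S_conv add.commute)
    ultimately show "conv (S m) q x = q x"
      by (rule LIMSEQ_unique)
  qed
  have "conv q q = q"
  proof
    fix x
    have "(\<lambda>n. conv q (S (Suc n)) x) \<longlonglongrightarrow> conv q q x"
      by (rule conv_tendsto[OF q_cont S_cont q_cont q])
    then show "conv q q x = q x"
      by (simp add: conv_commute[OF compact_group q_cont S_cont] Sq LIMSEQ_const_iff)
  qed
  moreover have "star q = q"
  proof
    fix x
    have "(\<lambda>n. star (S (Suc n)) x) \<longlonglongrightarrow> star q x"
      unfolding star_def by (intro tendsto_intros S_tendsto)
    then show "star q x = q x"
      unfolding S_star using S_tendsto[of x] by (rule LIMSEQ_unique)
  qed
  moreover have "q \<noteq> (\<lambda>x. 0)"
  proof
    assume "q = (\<lambda>x. 0)"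
    with S_tendsto[of 0] have "(\<lambda>n. Re (S (Suc n) 0)) \<longlonglongrightarrow> Re 0"
      by (intro tendsto_intros) simp
    moreover have "(\<lambda>n. Re (S (Suc n) 0)) \<longlonglongrightarrow> D"
      unfolding S_zero Re_complex_of_real by (rule LIMSEQ_Suc[OF D])
    ultimately show False
      using LIMSEQ_unique L(2) by fastforce
  qed
  ultimately have "hermitian_idempotent q"
    using q_cont by (simp add: hermitian_idempotent_def)
  moreover have "conv (conv r r) q = (\<lambda>x. of_real L * q x)"
  proof
    fix x
    have "conv r r = (\<lambda>x. of_real L * S 0 x)"
      using L(1) by (simp add: S_def fun_eq_iff)
    then show "conv (conv r r) q x = of_real L * q x"
      by (simp add: conv_cmult_left[OF compact_group S_cont q_cont] Sq)
  qed
  ultimately show thesis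
    using L(1) that by blast
qed

text \<open>
  The ideal generated by \<open>q\<close> has dimension \<open>q 0\<close>. That this number is at least 1 is seen directly:
  \<open>q = q * q\<close> is bounded by its own squared norm \<open>q 0\<close>, so \<open>q 0 \<le> (q 0)\<^sup>2\<close>.
\<close>

lemma hermitian_idempotent_zero:
  fixes q :: "'g \<Rightarrow> complex"
  assumes "hermitian_idempotent q"
  shows "q 0 = of_real (sqnorm q)" "sqnorm q \<ge> 1"
proof -
  have q: "continuous_on UNIV q" "star q = q" "conv q q = q" "q \<noteq> (\<lambda>x. 0)"
    using assms by (auto simp: hermitian_idempotent_def)
  show "q 0 = of_real (sqnorm q)"
    using conv_star_self[OF compact_group q(1)] q by simp
  have "(norm (q x))\<^sup>2 \<le> sqnorm q * sqnorm q" for x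
    using norm_conv_le[OF compact_group q(1) q(1), of x] q(3) by simp
  then have "sqnorm q \<le> sqnorm q * sqnorm q"
    by (rule sqnorm_le[OF compact_group q(1)])
  moreover have "sqnorm q > 0"
    using sqnorm_pos[OF compact_group q(1)] q(4) by auto
  ultimately show "sqnorm q \<ge> 1"
    by simp
qed

text \<open>
  Choose \<open>q1\<close> below \<open>q0\<close> with \<open>q1 0\<close> less than 1 above the infimum of such values. A
  different \<open>q2\<close> below \<open>q1\<close> would leave a hermitian idempotent \<open>q1 - q2\<close> whose value at 0 is
  at least 1, and then \<open>q2 0\<close> would be below the infimum.
\<close>

lemma minimal_idempotent_ex:
  fixes q0 :: "'g \<Rightarrow> complex"
  assumes "hermitian_idempotent q0"
  obtains q1 where "hermitian_idempotent q1" "conv q0 q1 = q1"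
    "\<And>q2. hermitian_idempotent q2 \<Longrightarrow> conv q1 q2 = q2 \<Longrightarrow> q2 = q1"
proof -
  let ?V = "{sqnorm q |q. hermitian_idempotent q \<and> conv q0 q = q}"
  have bdd: "bdd_below ?V"
    using hermitian_idempotent_zero(2) by (intro bdd_belowI[of _ 1]) auto
  have "sqnorm q0 \<in> ?V"
    using assms by (auto simp: hermitian_idempotent_def)
  then have "\<exists>v\<in>?V. v < Inf ?V + 1"
    using cInf_less_iff[OF _ bdd, of "Inf ?V + 1"] by force
  then obtain q1 where q1: "hermitian_idempotent q1" "conv q0 q1 = q1" "sqnorm q1 < Inf ?V + 1"
    by blast
  note q0' = assms[unfolded hermitian_idempotent_def]
  note q1' = q1(1)[unfolded hermitian_idempotent_def]
  have "q2 = q1" if q2: "hermitian_idempotent q2" "conv q1 q2 = q2" for q2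
  proof (rule ccontr)
    assume "q2 \<noteq> q1"
    note q2' = q2(1)[unfolded hermitian_idempotent_def]
    have "conv q0 q2 = q2"
      using conv_assoc[OF compact_group, of q0 q1 q2] q0' q1' q2' q1(2) q2(2) by simp
    then have "Inf ?V \<le> sqnorm q2"
      using q2(1) by (intro cInf_lower bdd) auto
    let ?p = "\<lambda>x. q1 x - q2 x"
    have p: "continuous_on UNIV ?p"
      using q1' q2' by (intro continuous_intros) auto
    have "conv q2 q1 = q2"
      using conv_commute[OF compact_group, of q1 q2] q1' q2' q2(2) by simp
    then have "conv ?p ?p = ?p"
      using q1' q2' q2(2) p by (simp add: conv_diff_left[OF compact_group] conv_diff_right)
    moreover have "star ?p = ?p"
      using q1' q2' by (simp add: star_def fun_eq_iff)
    moreover have "?p \<noteq> (\<lambda>x. 0)"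
      using \<open>q2 \<noteq> q1\<close> by (metis eq_iff_diff_eq_0 ext)
    ultimately have "hermitian_idempotent ?p"
      using p by (simp add: hermitian_idempotent_def)
    from hermitian_idempotent_zero[OF this] have "Re (?p 0) \<ge> 1"
      by simp
    then have "sqnorm q1 - sqnorm q2 \<ge> 1"
      using hermitian_idempotent_zero(1)[OF q1(1)] hermitian_idempotent_zero(1)[OF q2(1)] by simp
    with \<open>Inf ?V \<le> sqnorm q2\<close> q1(3) show False by simp
  qed
  with q1 show thesis by (intro that)
qed

context
  fixes q :: "'g \<Rightarrow> complex"
  assumes q_idem: "hermitian_idempotent q"
    and q_minimal: "\<And>q'. hermitian_idempotent q' \<Longrightarrow> conv q q' = q' \<Longrightarrow> q' = q"
begin

lemma idem_cont: "continuous_on UNIV q" and idem_star: "star q = q" and idem_conv: "conv q q = q"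
    and idem_zero: "q 0 \<noteq> 0"
  using q_idem hermitian_idempotent_zero[OF q_idem] by (auto simp: hermitian_idempotent_def)

text \<open>
  The iteration applied to \<open>r\<close> stays inside the ideal of \<open>q\<close>, so by minimality it returns \<open>q\<close> itself.
\<close>

lemma minimal_square:
  assumes r: "continuous_on UNIV r" "star r = r" "conv q r = r"
  shows "\<exists>c. conv r r = (\<lambda>x. c * q x)"
proof (cases "r = (\<lambda>x. 0)")
  case True
  then show ?thesis
    by (intro exI[of _ 0]) (simp add: conv_def mean_const fun_eq_iff)
next
  case False
  obtain L q' where L: "L > 0" and q': "hermitian_idempotent q'"
    and eq: "conv (conv r r) q' = (\<lambda>x. of_real L * q' x)"
    using power_method[OF r(1,2) False] by blast
  have q'_cont: "continuous_on UNIV q'"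
    using q' by (simp add: hermitian_idempotent_def)
  have rr: "continuous_on UNIV (conv r r)"
    by (intro continuous_convolution r)
  have qrr: "conv q (conv r r) = conv r r"
    using conv_assoc[OF compact_group idem_cont r(1) r(1)] r(3) by simp
  have "(\<lambda>x. of_real L * conv q q' x) = conv q (conv (conv r r) q')"
    by (simp add: eq conv_cmult_right idem_cont q'_cont)
  also have "\<dots> = conv (conv r r) q'"
    using conv_assoc[OF compact_group idem_cont rr q'_cont] qrr by simp
  finally have "conv q q' = q'"
    using L by (simp add: eq fun_eq_iff)
  then have "q' = q"
    using q_minimal q' by blast
  with eq qrr have "conv r r = (\<lambda>x. of_real L * q x)"
    using conv_commute[OF compact_group idem_cont rr] by simp
  then show ?thesis ..
qed

text \<open>
  Polarisation: \<open>r * r\<close> and \<open>(r + q) * (r + q) = r * r + 2 r + q\<close> are both multiples of \<open>q\<close>.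
\<close>

lemma minimal_hermitian:
  assumes r: "continuous_on UNIV r" "star r = r" "conv q r = r"
  shows "\<exists>c. r = (\<lambda>x. c * q x)"
proof -
  obtain c where c: "conv r r = (\<lambda>x. c * q x)"
    using minimal_square[OF r] by blast
  let ?s = "\<lambda>x. r x + q x"
  have s: "continuous_on UNIV ?s"
    by (intro continuous_intros r(1) idem_cont)
  moreover have "star ?s = ?s"
    using r(2) idem_star by (simp add: star_def fun_eq_iff)
  moreover have "conv q ?s = ?s"
    by (simp add: conv_add_right r idem_cont idem_conv)
  ultimately obtain d where d: "conv ?s ?s = (\<lambda>x. d * q x)"
    using minimal_square by blast
  have "conv r q = r"
    using conv_commute[OF compact_group idem_cont r(1)] r(3) by simp
  then have "conv ?s ?s = (\<lambda>x. c * q x + 2 * r x + q x)"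
    by (simp add: conv_add_left[OF compact_group] conv_add_right r idem_cont idem_conv c s fun_eq_iff)
  with d have "d * q x = c * q x + 2 * r x + q x" for x
    by (simp add: fun_eq_iff)
  then have "r x = (d - c - 1) / 2 * q x" for x
    by (simp add: field_simps)
  then show ?thesis by blast
qed

text \<open>
  Every \<open>f\<close> is a combination of the hermitian functions \<open>f + star f\<close> and \<open>\<i> (f - star f)\<close>.
\<close>

lemma minimal_one_dimensional:
  assumes f: "continuous_on UNIV f" "conv q f = f"
  shows "\<exists>c. f = (\<lambda>x. c * q x)"
proof -
  have sf: "continuous_on UNIV (star f)" "conv q (star f) = star f"
    using star_conv[OF compact_group idem_cont f(1)] f idem_star by (auto intro: continuous_convolution)
  have "\<exists>c. (\<lambda>x. f x + star f x) = (\<lambda>x. c * q x)"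
  proof (rule minimal_hermitian)
    show "star (\<lambda>x. f x + star f x) = (\<lambda>x. f x + star f x)"
      by (simp add: star_def fun_eq_iff add.commute)
  qed (auto intro!: continuous_intros simp: f sf conv_add_right idem_cont)
  moreover have "\<exists>d. (\<lambda>x. \<i> * (f x - star f x)) = (\<lambda>x. d * q x)"
  proof (rule minimal_hermitian)
    show "star (\<lambda>x. \<i> * (f x - star f x)) = (\<lambda>x. \<i> * (f x - star f x))"
      by (simp add: star_def fun_eq_iff algebra_simps)
    have d: "continuous_on UNIV (\<lambda>x. f x - star f x)"
      by (intro continuous_intros f sf)
    show "conv q (\<lambda>x. \<i> * (f x - star f x)) = (\<lambda>x. \<i> * (f x - star f x))"
      by (simp add: conv_cmult_right d conv_diff_right f sf idem_cont)
  qed (auto intro!: continuous_intros simp: f sf)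
  ultimately obtain c d where c: "\<And>x. f x + star f x = c * q x"
    and d: "\<And>x. \<i> * (f x - star f x) = d * q x"
    by (auto simp: fun_eq_iff)
  have "f x = (c - \<i> * d) / 2 * q x" for x
  proof -
    have "2 * f x = (f x + star f x) - \<i> * (\<i> * (f x - star f x))"
      by (simp add: algebra_simps)
    also have "\<dots> = (c - \<i> * d) * q x"
      unfolding c d by (simp add: algebra_simps)
    finally show ?thesis by (simp add: field_simps)
  qed
  then show ?thesis by blast
qed

text \<open>
  The ideal of \<open>q\<close> is invariant under translations and consists of the multiples of \<open>q\<close>, so
  translating \<open>q\<close> by \<open>a\<close> multiplies it by a scalar, which is found by evaluation at 0.
\<close>

lemma minimal_multiplicative: "q (a + x) * q 0 = q a * q x"
proof -
  have "conv q (\<lambda>x. q (a + x)) = (\<lambda>x. q (a + x))"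
    using conv_commute[OF compact_group idem_cont continuous_shift[OF compact_group idem_cont, of a]]
    by (simp add: conv_shift_left idem_conv)
  then obtain c where c: "\<And>x. q (a + x) = c * q x"
    using minimal_one_dimensional[OF continuous_shift[OF compact_group idem_cont]] by meson
  from c[of 0] c[of x] show ?thesis by simp
qed

lemma minimal_group_character: "(\<lambda>x. q x / q 0) \<in> group_characters"
proof -
  let ?\<psi> = "\<lambda>x. q x / q 0"
  have mult: "?\<psi> (x + y) = ?\<psi> x * ?\<psi> y" for x y
    using minimal_multiplicative[of x y] idem_zero by (simp add: field_simps)
  have "norm (?\<psi> x) = 1" for x
  proof -
    have "cnj (q x) = q (- x)" "cnj (q 0) = q 0"
      using fun_cong[OF idem_star, of "- x"] fun_cong[OF idem_star, of 0] by (simp_all add: star_def)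
    then have "?\<psi> x * cnj (?\<psi> x) = ?\<psi> (x + - x)"
      unfolding mult by simp
    also have "\<dots> = 1"
      using idem_zero by simp
    finally have "norm (?\<psi> x * cnj (?\<psi> x)) = 1"
      by (simp only: norm_one)
    then show ?thesis
      unfolding norm_mult complex_mod_cnj by (metis real_sqrt_abs2 abs_norm_cancel real_sqrt_one)
  qed
  moreover have "continuous_on UNIV ?\<psi>"
    using idem_zero by (intro continuous_intros idem_cont) auto
  ultimately show ?thesis
    using mult by (simp add: group_characters_def)
qed

end

text \<open>
  Let \<open>f\<close> be the difference of \<open>k\<close> and its translate by \<open>g\<close>. Convolution by \<open>f\<close> annihilates every
  character that is 1 at \<open>g\<close>. Power iteration for \<open>star f * f\<close> yields an idempotent on which the
  square of that function acts by a nonzero scalar, and a minimal idempotent below it is, up to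
  normalisation, a character that \<open>f\<close> does not annihilate.
\<close>

lemma character_separates_if_function_does:
  fixes k :: "'g \<Rightarrow> complex"
  assumes k: "continuous_on UNIV k" and kg: "k g \<noteq> k 0"
  shows "\<exists>\<psi>\<in>group_characters. \<psi> g \<noteq> 1"
proof -
  define f where "f x = k x - k (g + x)" for x
  have k': "continuous_on UNIV (\<lambda>x. k (g + x))"
    by (intro continuous_convolution k compact_group)
  have f: "continuous_on UNIV f"
    unfolding f_def[abs_def] by (intro continuous_intros k k')
  have sf: "continuous_on UNIV (star f)"
    by (intro continuous_convolution f)
  define r where "r = conv (star f) f"
  have r: "continuous_on UNIV r"
    unfolding r_def by (intro continuous_convolution f)
  have r_star: "star r = r"
    by (simp add: r_def star_conv[OF compact_group sf f] star_star conv_commute[OF compact_group f sf])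
  have "r 0 = of_real (sqnorm f)"
    unfolding r_def conv_commute[OF compact_group sf f] by (rule conv_star_self[OF compact_group f])
  moreover have "sqnorm f > 0"
    using kg by (intro sqnorm_pos[OF compact_group f, of 0]) (simp add: f_def)
  ultimately have "r \<noteq> (\<lambda>x. 0)" by auto
  then obtain L q0 where L: "L > 0" and q0: "hermitian_idempotent q0"
    and eq: "conv (conv r r) q0 = (\<lambda>x. of_real L * q0 x)"
    using power_method[OF r r_star] by blast
  obtain q where q: "hermitian_idempotent q" "conv q0 q = q"
    "\<And>q'. hermitian_idempotent q' \<Longrightarrow> conv q q' = q' \<Longrightarrow> q' = q"
    using minimal_idempotent_ex[OF q0] by blast
  have q_cont: "continuous_on UNIV q" "continuous_on UNIV q0"
    using q(1) q0 by (auto simp: hermitian_idempotent_def)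
  have rr: "continuous_on UNIV (conv r r)"
    by (intro continuous_convolution r)
  have "conv (conv r r) q = conv (conv (conv r r) q0) q"
    using conv_assoc[OF compact_group rr q_cont(2,1)] q(2) by simp
  also have "\<dots> = (\<lambda>x. of_real L * q x)"
    by (simp add: eq conv_cmult_left[OF compact_group] q_cont q(2))
  finally have rrq: "conv (conv r r) q = (\<lambda>x. of_real L * q x)" .
  have q_zero: "q 0 \<noteq> 0"
    using hermitian_idempotent_zero[OF q(1)] by auto
  have "q g / q 0 \<noteq> 1"
  proof
    assume "q g / q 0 = 1"
    then have "q (g + x) = q x" for x
      using minimal_multiplicative[OF q(1,3), of g x] q_zero by (simp add: field_simps)
    then have shift: "(\<lambda>x. q (g + x)) = q"
      by (intro ext)
    have "conv (\<lambda>x. k (g + x)) q = (\<lambda>x. conv k q (g + x))"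
      by (rule conv_shift_left)
    also have "\<dots> = conv (\<lambda>x. q (g + x)) k"
      unfolding conv_commute[OF compact_group k q_cont(1)] by (rule conv_shift_left[symmetric])
    also have "\<dots> = conv k q"
      unfolding shift by (rule conv_commute[OF compact_group q_cont(1) k])
    finally have "conv (\<lambda>x. k (g + x)) q = conv k q" .
    then have "conv f q = (\<lambda>x. 0)"
      unfolding f_def[abs_def] by (simp add: conv_diff_left[OF compact_group k k' q_cont(1)])
    moreover have zero: "conv h (\<lambda>x. 0) = (\<lambda>x. 0)" for h :: "'g \<Rightarrow> complex"
      by (simp add: conv_def mean_const fun_eq_iff)
    ultimately have "conv r q = (\<lambda>x. 0)"
      by (simp add: r_def conv_assoc[OF compact_group sf f q_cont(1)])
    then have "conv (conv r r) q = (\<lambda>x. 0)"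
      by (simp add: conv_assoc[OF compact_group r r q_cont(1)] zero)
    with rrq L q_zero show False
      by (auto simp: fun_eq_iff)
  qed
  then show ?thesis
    using minimal_group_character[OF q(1)] q(3) by (intro bexI[of _ "\<lambda>x. q x / q 0"]) auto
qed

end

text \<open>
  The Peter--Weyl theorem for abelian groups: Urysohn's lemma supplies the function \<open>k\<close> with
  \<open>k g \<noteq> k 0\<close>.
\<close>

theorem group_characters_separate:
  fixes g :: "'g::{topological_ab_group_add, t2_space}"
  assumes compact_group: "compact (UNIV :: 'g set)" and "g \<noteq> 0"
  obtains \<psi> where "\<psi> \<in> group_characters" "\<psi> g \<noteq> 1"
proof -
  have "Hausdorff_space (euclidean :: 'g topology)"
    unfolding Hausdorff_space_def disjnt_def open_openin[symmetric] using hausdorff by blast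
  then have "normal_space (euclidean :: 'g topology)"
    using compact_group
    by (intro compact_Hausdorff_or_regular_imp_normal_space)
       (simp_all add: compact_space_def)
  then obtain k :: "'g \<Rightarrow> real" where
    k: "continuous_map euclidean euclideanreal k" "k ` {0} \<subseteq> {0}" "k ` {g} \<subseteq> {1}"
    using Urysohn_lemma_alt[of euclidean "{0}" "{g}" 0 1] \<open>g \<noteq> 0\<close> by auto
  have "continuous_on UNIV (\<lambda>x. complex_of_real (k x))"
    using k(1) by (intro continuous_intros) simp
  moreover have "complex_of_real (k g) \<noteq> complex_of_real (k 0)"
    using k by auto
  ultimately show thesis
    using character_separates_if_function_does[OF compact_group] that by blast
qed

section \<open>Tensor products\<close>

lemma carrier_complex_ring [simp]: "c \<in> carrier complex_ring"
  by (simp add: complex_ring_def)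

lemma cring_complex_ring: "cring complex_ring"
proof (rule cringI)
  show "abelian_group complex_ring"
    by (rule abelian_groupI) (auto simp: complex_ring_def add.assoc add.commute intro: exI[of _ "- x" for x :: complex])
qed (auto intro!: comm_monoidI simp: complex_ring_def distrib_right)

lemma frag_sum_add:
  fixes w :: "'p \<Rightarrow> complex"
  shows "(\<Sum>p\<in>Poly_Mapping.keys (x + y). of_int (Poly_Mapping.lookup (x + y) p) * w p) =
    (\<Sum>p\<in>Poly_Mapping.keys x. of_int (Poly_Mapping.lookup x p) * w p) +
    (\<Sum>p\<in>Poly_Mapping.keys y. of_int (Poly_Mapping.lookup y p) * w p)"
proof -
  have *: "(\<Sum>p\<in>Poly_Mapping.keys z. of_int (Poly_Mapping.lookup z p) * w p) =
      (\<Sum>p\<in>Poly_Mapping.keys x \<union> Poly_Mapping.keys y. of_int (Poly_Mapping.lookup z p) * w p)"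
    if "Poly_Mapping.keys z \<subseteq> Poly_Mapping.keys x \<union> Poly_Mapping.keys y" for z
    using that by (intro sum.mono_neutral_left) (auto simp: in_keys_iff)
  let ?K = "Poly_Mapping.keys x \<union> Poly_Mapping.keys y"
  have "(\<Sum>p\<in>Poly_Mapping.keys (x + y). of_int (Poly_Mapping.lookup (x + y) p) * w p) =
      (\<Sum>p\<in>?K. of_int (Poly_Mapping.lookup (x + y) p) * w p)"
    by (rule *[OF keys_add])
  also have "\<dots> = (\<Sum>p\<in>?K. of_int (Poly_Mapping.lookup x p) * w p) +
      (\<Sum>p\<in>?K. of_int (Poly_Mapping.lookup y p) * w p)"
    by (simp add: lookup_add distrib_right sum.distrib)
  finally show ?thesis
    by (simp only: *[of x, OF Un_upper1] *[of y, OF Un_upper2])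
qed

context
  fixes A :: "(complex, 'a, 'm) module_scheme" and V :: "(complex, 'v, 'n) module_scheme"
  assumes A: "Module.module complex_ring A" and V: "Module.module complex_ring V"
begin

interpretation A: Module.module complex_ring A by fact
interpretation V: Module.module complex_ring V by fact

lemma tensor_relationsI:
  assumes "a \<in> carrier A" "v \<in> carrier V"
  shows "b \<in> carrier A \<Longrightarrow>
      frag_of (a \<oplus>\<^bsub>A\<^esub> b, v) - frag_of (a, v) - frag_of (b, v) \<in> tensor_relations A V"
    and "w \<in> carrier V \<Longrightarrow>
      frag_of (a, v \<oplus>\<^bsub>V\<^esub> w) - frag_of (a, v) - frag_of (a, w) \<in> tensor_relations A V"
    and "frag_of (c \<odot>\<^bsub>A\<^esub> a, v) - frag_of (a, c \<odot>\<^bsub>V\<^esub> v) \<in> tensor_relations A V"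
  using assms unfolding tensor_relations_def by blast+

lemma keys_tensor_relations:
  assumes "r \<in> tensor_relations A V"
  shows "Poly_Mapping.keys r \<subseteq> carrier A \<times> carrier V"
proof -
  have "Poly_Mapping.keys (frag_of p - frag_of p') \<subseteq> S"
    if "p \<in> S" "p' \<in> S" for p p' and S :: "('a \<times> 'v) set"
    using that keys_diff[of "frag_of p" "frag_of p'"] by auto
  moreover have "Poly_Mapping.keys (frag_of p - frag_of p' - frag_of p'') \<subseteq> S"
    if "p \<in> S" "p' \<in> S" "p'' \<in> S" for p p' p'' and S :: "('a \<times> 'v) set"
    using that keys_diff[of "frag_of p" "frag_of p'"] keys_diff[of "frag_of p - frag_of p'" "frag_of p''"]
    by auto
  ultimately show ?thesis
    using assms unfolding tensor_relations_def by (elim UnE CollectE exE conjE) simp_all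
qed

lemma tensor_kernel_closed:
  shows "0 \<in> tensor_kernel A V"
    and "x \<in> tensor_kernel A V \<Longrightarrow> y \<in> tensor_kernel A V \<Longrightarrow> x + y \<in> tensor_kernel A V"
    and "x \<in> tensor_kernel A V \<Longrightarrow> - x \<in> tensor_kernel A V"
    and "x \<in> tensor_kernel A V \<Longrightarrow> Poly_Mapping.keys x \<subseteq> carrier A \<times> carrier V"
proof -
  let ?F = "free_Abelian_group (carrier A \<times> carrier V)"
  have "tensor_relations A V \<subseteq> carrier ?F"
    using keys_tensor_relations by auto
  then interpret subgroup "tensor_kernel A V" ?F
    unfolding tensor_kernel_def by (rule group.generate_is_subgroup[OF group_free_Abelian_group])
  show "0 \<in> tensor_kernel A V"
    using one_closed by simp
  show "x + y \<in> tensor_kernel A V" if "x \<in> tensor_kernel A V" "y \<in> tensor_kernel A V"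
    using m_closed[OF that] by simp
  show keys: "Poly_Mapping.keys x \<subseteq> carrier A \<times> carrier V" if "x \<in> tensor_kernel A V"
    using mem_carrier[OF that] by simp
  show "- x \<in> tensor_kernel A V" if "x \<in> tensor_kernel A V"
    using m_inv_closed[OF that] keys[OF that] by simp
qed

lemma tensor_kernel_induct [consumes 1, case_names zero relation minus plus]:
  assumes "k \<in> tensor_kernel A V"
    and "P 0" "\<And>r. r \<in> tensor_relations A V \<Longrightarrow> P r"
    "\<And>x. P x \<Longrightarrow> P (- x)" "\<And>x y. P x \<Longrightarrow> P y \<Longrightarrow> P (x + y)"
  shows "P k"
  using assms(1) unfolding tensor_kernel_def
proof (induction rule: generate.induct)
  case (inv h)
  then show ?case
    using assms(3,4) keys_tensor_relations by simp
qed (auto intro: assms)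

lemma tensor_class_eq: "tensor_class A V x = {k + x |k. k \<in> tensor_kernel A V}"
  by (auto simp: tensor_class_def r_coset_def)

lemma self_in_tensor_class: "x \<in> tensor_class A V x"
  using tensor_kernel_closed(1) by (force simp: tensor_class_eq)

lemma tensor_class_eqI:
  assumes "x - y \<in> tensor_kernel A V"
  shows "tensor_class A V x = tensor_class A V y"
proof -
  have "tensor_class A V x \<subseteq> tensor_class A V y" if "x - y \<in> tensor_kernel A V" for x y
  proof
    fix z assume "z \<in> tensor_class A V x"
    then obtain k where "k \<in> tensor_kernel A V" "z = (k + (x - y)) + y"
      by (auto simp: tensor_class_eq)
    with that tensor_kernel_closed(2) show "z \<in> tensor_class A V y"
      unfolding tensor_class_eq by blast
  qed
  from this[OF assms] this[of y x] tensor_kernel_closed(3)[OF assms] show ?thesis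
    by simp
qed

lemma carrier_tensor_product:
  "carrier (tensor_product A V) =
    tensor_class A V ` {x. Poly_Mapping.keys x \<subseteq> carrier A \<times> carrier V}"
  by (auto simp: tensor_product_def FactGroup_def RCOSETS_def tensor_class_def)

text \<open>
  The map is well defined on cosets: the extension of \<open>(a, v) \<mapsto> (f a, h v)\<close> to the free abelian group
  takes relations to relations, since \<open>f\<close> and \<open>h\<close> are linear, and hence the kernel to itself.
\<close>

lemma tensor_map_class:
  assumes f: "linear_endo A f" and h: "linear_endo V h"
  shows "tensor_map A V f h (tensor_class A V x) =
    tensor_class A V (frag_extend (\<lambda>(a, v). frag_of (f a, h v)) x)"
proof -
  define F where "F = frag_extend (\<lambda>(a, v). frag_of (f a, h v))"
  have F_rel: "F r \<in> tensor_relations A V" if "r \<in> tensor_relations A V" for r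
  proof -
    have f': "f a \<in> carrier A" "f (a \<oplus>\<^bsub>A\<^esub> b) = f a \<oplus>\<^bsub>A\<^esub> f b" "f (c \<odot>\<^bsub>A\<^esub> a) = c \<odot>\<^bsub>A\<^esub> f a"
      if "a \<in> carrier A" "b \<in> carrier A" for a b c
      using f that by (auto simp: linear_endo_def)
    have h': "h v \<in> carrier V" "h (v \<oplus>\<^bsub>V\<^esub> w) = h v \<oplus>\<^bsub>V\<^esub> h w" "h (c \<odot>\<^bsub>V\<^esub> v) = c \<odot>\<^bsub>V\<^esub> h v"
      if "v \<in> carrier V" "w \<in> carrier V" for v w c
      using h that by (auto simp: linear_endo_def)
    show ?thesis
      using that[unfolded tensor_relations_def Un_iff mem_Collect_eq]
      by (elim disjE exE conjE) (simp_all add: F_def frag_extend_diff f' h' tensor_relationsI)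
  qed
  have F_kernel: "F k \<in> tensor_kernel A V" if "k \<in> tensor_kernel A V" for k
    using that
  proof (induction rule: tensor_kernel_induct)
    case (relation r)
    then show ?case
      unfolding tensor_kernel_def by (intro generate.incl F_rel)
  qed (simp_all add: F_def frag_extend_minus frag_extend_add tensor_kernel_closed)
  have "tensor_class A V (F y) = tensor_class A V (F x)" if "y \<in> tensor_class A V x" for y
  proof -
    from that obtain k where "k \<in> tensor_kernel A V" "y = k + x"
      by (auto simp: tensor_class_eq)
    then show ?thesis
      using F_kernel by (intro tensor_class_eqI) (simp add: F_def frag_extend_add)
  qed
  then have "(\<lambda>y. tensor_class A V (F y)) ` tensor_class A V x = {tensor_class A V (F x)}"
    using self_in_tensor_class by blast
  then show ?thesis
    by (simp add: tensor_map_def F_def)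
qed

end

section \<open>One-dimensional representations\<close>

text \<open>
  The complex numbers, realised as constant functions so as to lie in the type of the
  representation spaces.
\<close>

definition complex_line :: "(complex, 'p \<Rightarrow> complex) module"
  where "complex_line = \<lparr>carrier = range (\<lambda>c p. c), mult = (\<lambda>v w p. v p * w p), one = (\<lambda>p. 1),
    ring.zero = (\<lambda>p. 0), add = (\<lambda>v w p. v p + w p), smult = (\<lambda>c v p. c * v p)\<rparr>"

text \<open>
  The topology of the complex plane, transported along evaluation at an arbitrary point, which is
  a bijection from the constant functions to the complex numbers.
\<close>

definition line_topology :: "('p \<Rightarrow> complex) topology"
  where "line_topology = pullback_topology (range (\<lambda>c p. c)) (\<lambda>v. v undefined) euclidean"

definition line_rep :: "('g \<Rightarrow> complex) \<Rightarrow> 'g \<Rightarrow> ('p \<Rightarrow> complex) \<Rightarrow> 'p \<Rightarrow> complex"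
  where "line_rep \<psi> g v = (\<lambda>p. \<psi> g * v p)"

lemma complex_line_simps:
  "v \<in> carrier complex_line \<longleftrightarrow> (\<exists>c. v = (\<lambda>p. c))"
  "\<zero>\<^bsub>complex_line\<^esub> = (\<lambda>p. 0)"
  "v \<oplus>\<^bsub>complex_line\<^esub> w = (\<lambda>p. v p + w p)"
  "c \<odot>\<^bsub>complex_line\<^esub> v = (\<lambda>p. c * v p)"
  by (auto simp: complex_line_def)

lemma abelian_group_complex_line: "abelian_group complex_line"
proof (rule abelian_groupI)
  show "\<exists>w\<in>carrier complex_line. w \<oplus>\<^bsub>complex_line\<^esub> v = \<zero>\<^bsub>complex_line\<^esub>"
    if "v \<in> carrier complex_line" for v :: "'p \<Rightarrow> complex"
    using that by (intro bexI[of _ "\<lambda>p. - v p"]) (auto simp: complex_line_simps)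
qed (auto simp: complex_line_simps algebra_simps)

lemma module_complex_line:
  "Module.module complex_ring (complex_line :: (complex, 'p \<Rightarrow> complex) module)"
  by (rule Module.moduleI[OF cring_complex_ring abelian_group_complex_line])
     (auto simp: complex_line_simps complex_ring_def algebra_simps)

lemma finsum_complex_line:
  assumes "finite K" "\<And>k. k \<in> K \<Longrightarrow> f k \<in> carrier complex_line"
  shows "(\<Oplus>\<^bsub>complex_line\<^esub>k\<in>K. f k) = (\<lambda>p. \<Sum>k\<in>K. f k p)"
proof -
  interpret abelian_group complex_line
    by (rule abelian_group_complex_line)
  show ?thesis
    using assms
  proof (induction K)
    case (insert k K)
    then show ?case
      by (subst finsum_insert) (auto simp: complex_line_simps(3))
  qed (simp add: complex_line_simps(2))
qed

lemma continuous_map_complex_mult: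
  fixes f g :: "'x \<Rightarrow> complex"
  shows "\<lbrakk>continuous_map X0 euclidean f; continuous_map X0 euclidean g\<rbrakk>
    \<Longrightarrow> continuous_map X0 euclidean (\<lambda>x. f x * g x)"
  by (simp add: continuous_map_atin tendsto_mult)

lemma continuous_map_line_topology:
  "continuous_map Y line_topology f \<longleftrightarrow>
    f \<in> topspace Y \<rightarrow> range (\<lambda>c p. c) \<and> continuous_map Y euclidean (\<lambda>y. f y undefined)"
proof
  have proj: "continuous_map line_topology euclidean (\<lambda>v. v undefined)"
    using continuous_map_pullback[OF continuous_map_id] by (simp add: line_topology_def o_def)
  assume f: "continuous_map Y line_topology f"
  then show "f \<in> topspace Y \<rightarrow> range (\<lambda>c p. c) \<and> continuous_map Y euclidean (\<lambda>y. f y undefined)"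
    using continuous_map_compose[OF f proj]
    by (auto simp: o_def continuous_map_def line_topology_def topspace_pullback_topology)
next
  assume "f \<in> topspace Y \<rightarrow> range (\<lambda>c p. c) \<and> continuous_map Y euclidean (\<lambda>y. f y undefined)"
  then show "continuous_map Y line_topology f"
    unfolding line_topology_def by (intro continuous_map_pullback') (auto simp: o_def)
qed

lemma topspace_line_topology: "topspace line_topology = range (\<lambda>c p. c)"
  by (simp add: line_topology_def topspace_pullback_topology)

lemma line_coordinate_continuous:
  "continuous_map Y line_topology f \<Longrightarrow> continuous_map Y euclidean (\<lambda>y. f y undefined)"
  by (simp add: continuous_map_line_topology)

lemmas line_coordinates_continuous =
  line_coordinate_continuous[OF continuous_map_id, unfolded id_apply]
  line_coordinate_continuous[OF continuous_map_fst]
  line_coordinate_continuous[OF continuous_map_snd]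

lemma continuous_representation_line:
  fixes \<phi> :: "'g::topological_group_add \<Rightarrow> complex"
  assumes "\<phi> \<in> group_characters"
  shows "continuous_representation (complex_line :: (complex, 'p \<Rightarrow> complex) module)
    line_topology (line_rep \<phi>)"
proof -
  have \<phi>: "continuous_on UNIV \<phi>" "\<phi> (g + h) = \<phi> g * \<phi> h" "\<phi> 0 = 1" for g h
  proof -
    have "\<phi> (0 + 0) = \<phi> 0 * \<phi> 0" "norm (\<phi> 0) = 1"
      using assms unfolding group_characters_def by blast+
    then show "\<phi> 0 = 1" by auto
  qed (use assms in \<open>auto simp: group_characters_def\<close>)
  interpret Module.module complex_ring "complex_line :: (complex, 'p \<Rightarrow> complex) module"
    by (rule module_complex_line)
  show ?thesis
  proof unfold_locales
    show "topspace line_topology = carrier (complex_line :: (complex, 'p \<Rightarrow> complex) module)"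
      by (simp add: topspace_line_topology complex_line_def)
    show "continuous_map (prod_topology line_topology line_topology) line_topology
        (\<lambda>(x, y). x \<oplus>\<^bsub>complex_line\<^esub> y :: 'p \<Rightarrow> complex)"
      unfolding continuous_map_line_topology complex_line_simps case_prod_beta
      by (auto simp: topspace_line_topology intro!: continuous_map_add line_coordinates_continuous)
    show "continuous_map (prod_topology euclidean line_topology) line_topology
        (\<lambda>(c, x). c \<odot>\<^bsub>complex_line\<^esub> x :: 'p \<Rightarrow> complex)"
      unfolding continuous_map_line_topology complex_line_simps case_prod_beta
      by (auto simp: topspace_line_topology intro!: continuous_map_complex_mult line_coordinates_continuous
          continuous_map_fst)
    show "continuous_map (prod_topology euclidean line_topology) line_topology
        (\<lambda>(g, v). line_rep \<phi> g v :: 'p \<Rightarrow> complex)"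
      unfolding continuous_map_line_topology line_rep_def case_prod_beta
      using \<phi>(1) continuous_map_compose[OF continuous_map_fst, of euclidean euclidean \<phi>]
      by (auto simp: topspace_line_topology o_def intro!: continuous_map_complex_mult
          line_coordinates_continuous)
    have "continuous_map line_topology euclidean (\<lambda>v :: 'p \<Rightarrow> complex. v undefined)"
      by (rule line_coordinates_continuous)
    then show "Hausdorff_space (line_topology :: ('p \<Rightarrow> complex) topology)"
      by (rule Hausdorff_space_injective_preimage[rotated])
         (auto simp: topspace_line_topology inj_on_def)
    show "\<exists>W. openin line_topology W \<and> \<zero>\<^bsub>complex_line\<^esub> \<in> W \<and> W \<subseteq> U \<and>
        (\<forall>x\<in>W. \<forall>y\<in>W. \<forall>t\<in>{0..1}. complex_of_real t \<odot>\<^bsub>complex_line\<^esub> x \<oplus>\<^bsub>complex_line\<^esub>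
          complex_of_real (1 - t) \<odot>\<^bsub>complex_line\<^esub> y \<in> W)"
      if U: "openin line_topology U" "\<zero>\<^bsub>complex_line\<^esub> \<in> U" for U :: "('p \<Rightarrow> complex) set"
    proof -
      let ?R = "range (\<lambda>c (p :: 'p). c :: complex)"
      obtain U0 where U0: "open U0" "U = (\<lambda>v. v undefined) -` U0 \<inter> ?R"
        using U(1) by (auto simp: line_topology_def openin_pullback_topology)
      with U(2) have "0 \<in> U0"
        by (simp add: complex_line_simps)
      with U0(1) obtain e where e: "e > 0" "ball 0 e \<subseteq> U0"
        by (meson openE)
      let ?W = "(\<lambda>v. v undefined) -` ball 0 e \<inter> ?R"
      have "openin line_topology ?W"
        unfolding line_topology_def openin_pullback_topology by (intro exI[of _ "ball 0 e"]) auto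
      moreover have "\<zero>\<^bsub>complex_line\<^esub> \<in> ?W"
        using e(1) by (auto simp: complex_line_simps)
      moreover have "?W \<subseteq> U"
        using e(2) U0(2) by blast
      moreover have "complex_of_real t \<odot>\<^bsub>complex_line\<^esub> x \<oplus>\<^bsub>complex_line\<^esub>
          complex_of_real (1 - t) \<odot>\<^bsub>complex_line\<^esub> y \<in> ?W"
        if "x \<in> ?W" "y \<in> ?W" "t \<in> {0..1}" for x y and t :: real
      proof -
        have "t *\<^sub>R x undefined + (1 - t) *\<^sub>R y undefined \<in> ball 0 e"
          using that by (intro convexD[OF convex_ball]) auto
        then show ?thesis
          using that by (auto simp: complex_line_simps scaleR_conv_of_real)
      qed
      ultimately show ?thesis
        by (intro exI[of _ ?W] conjI ballI)
    qed
    show "linear_endo complex_line (line_rep \<phi> g :: _ \<Rightarrow> 'p \<Rightarrow> complex)" for g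
      by (auto simp: linear_endo_def line_rep_def complex_line_simps algebra_simps)
    show "line_rep \<phi> 0 v = v" for v :: "'p \<Rightarrow> complex"
      by (simp add: line_rep_def \<phi>(3))
    show "line_rep \<phi> (g + h) v = line_rep \<phi> g (line_rep \<phi> h v)" for g h and v :: "'p \<Rightarrow> complex"
      by (simp add: line_rep_def \<phi>(2) mult.assoc)
  qed
qed

text \<open>
  The coordinate of \<open>\<omega> \<otimes> id\<close> on the line. In contrast to the sum that defines
  \<^const>\<open>tensor_eval\<close> it is additive on all of the free abelian group.
\<close>

definition pairing :: "('a \<Rightarrow> complex) \<Rightarrow> ('a \<times> ('p \<Rightarrow> complex) \<Rightarrow>\<^sub>0 int) \<Rightarrow> complex"
  where "pairing \<omega> x = (\<Sum>p\<in>Poly_Mapping.keys x.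
    of_int (Poly_Mapping.lookup x p) * (\<omega> (fst p) * snd p undefined))"

lemma pairing_simps [simp]:
  "pairing \<omega> 0 = 0" "pairing \<omega> (x + y) = pairing \<omega> x + pairing \<omega> y"
  "pairing \<omega> (frag_of p) = \<omega> (fst p) * snd p undefined"
  by (simp_all add: pairing_def frag_sum_add)

lemma pairing_minus [simp]: "pairing \<omega> (- x) = - pairing \<omega> x"
  using pairing_simps(2)[of \<omega> x "- x"] by (simp add: eq_neg_iff_add_eq_0 add.commute)

lemma pairing_diff [simp]: "pairing \<omega> (x - y) = pairing \<omega> x - pairing \<omega> y"
  using pairing_simps(2)[of \<omega> x "- y"] by simp

text \<open>
  The pairing vanishes on the tensor relations, because \<open>\<omega>\<close> is linear, and hence is constant on
  cosets.
\<close>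

lemma tensor_eval_line:
  fixes A :: "(complex, 'a, 'm) module_scheme"
  assumes A: "Module.module complex_ring A" and \<omega>: "\<omega> \<in> algebra_characters A"
    and x: "Poly_Mapping.keys x \<subseteq> carrier A \<times> carrier complex_line"
  shows "tensor_eval (complex_line :: (complex, 'p \<Rightarrow> complex) module) \<omega> (tensor_class A complex_line x) =
    (\<lambda>p. pairing \<omega> x)"
proof -
  note V = module_complex_line[where 'p = 'p]
  let ?E = "\<lambda>x :: 'a \<times> ('p \<Rightarrow> complex) \<Rightarrow>\<^sub>0 int. \<Oplus>\<^bsub>complex_line\<^esub>p\<in>Poly_Mapping.keys x.
      (of_int (Poly_Mapping.lookup x p) * \<omega> (fst p)) \<odot>\<^bsub>complex_line\<^esub> snd p"
  have \<omega>': "\<omega> (a \<oplus>\<^bsub>A\<^esub> b) = \<omega> a + \<omega> b" "\<omega> (c \<odot>\<^bsub>A\<^esub> a) = c * \<omega> a"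
    if "a \<in> carrier A" "b \<in> carrier A" for a b c
    using \<omega> that by (auto simp: algebra_characters_def)
  have kernel: "pairing \<omega> k = 0" if "k \<in> tensor_kernel A (complex_line :: (complex, 'p \<Rightarrow> complex) module)" for k
  proof (rule tensor_kernel_induct[OF A V that])
    show "pairing \<omega> r = 0" if "r \<in> tensor_relations A (complex_line :: (complex, 'p \<Rightarrow> complex) module)" for r
      using that unfolding tensor_relations_def
      by (elim UnE CollectE exE conjE)
         (simp_all add: \<omega>' complex_line_simps(3,4) distrib_left distrib_right)
  qed simp_all
  have E: "?E y = (\<lambda>p. pairing \<omega> x)" if y: "y \<in> tensor_class A complex_line x" for y
  proof -
    obtain k where k: "k \<in> tensor_kernel A complex_line" "y = k + x"
      using y by (auto simp: tensor_class_eq[OF A V])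
    have "Poly_Mapping.keys y \<subseteq> carrier A \<times> carrier complex_line"
      using keys_add[of k x] tensor_kernel_closed(4)[OF A V k(1)] x k(2) by blast
    then have const: "\<exists>c. snd p = (\<lambda>_. c)" if "p \<in> Poly_Mapping.keys y" for p
      using that by (auto simp: complex_line_simps(1))
    then have "?E y = (\<lambda>q. \<Sum>p\<in>Poly_Mapping.keys y. (of_int (Poly_Mapping.lookup y p) * \<omega> (fst p)) * snd p q)"
    proof (subst finsum_complex_line)
      show "(of_int (Poly_Mapping.lookup y p) * \<omega> (fst p)) \<odot>\<^bsub>complex_line\<^esub> snd p
          \<in> carrier complex_line" if "p \<in> Poly_Mapping.keys y" for p
        using const[OF that] by (auto simp: complex_line_simps)
    qed (simp_all add: complex_line_simps(4))
    also have "\<dots> = (\<lambda>q. pairing \<omega> y)"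
      unfolding pairing_def using const by (intro ext sum.cong) force+
    also have "pairing \<omega> y = pairing \<omega> x"
      using k kernel by simp
    finally show ?thesis .
  qed
  have "?E ` tensor_class A complex_line x = (\<lambda>y p. pairing \<omega> x) ` tensor_class A complex_line x"
    by (intro image_cong refl E)
  also have "\<dots> = {\<lambda>p. pairing \<omega> x}"
    by (rule image_constant[OF self_in_tensor_class[OF A V]])
  finally show ?thesis
    by (simp add: tensor_eval_def)
qed

text \<open>
  On the pure tensor of \<open>a\<close> and \<open>v\<close> both sides of the equivariance condition multiply by the scalar
  \<open>\<psi> g\<close>, one in the first factor and one in the second, and scalars may cross the tensor sign.
\<close>

lemma equivariant_pure_tensor:
  fixes A :: "(complex, 'a) module" and \<alpha> :: "'g::topological_group_add \<Rightarrow> 'a \<Rightarrow> 'a"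
  assumes sys: "dynamical_system A T \<alpha>" and rep: "continuous_representation V S \<pi>"
    and a: "a \<in> isotypic_component A \<alpha> \<psi>"
    and v: "v \<in> carrier V" "\<And>g. \<pi> (- g) v = \<psi> g \<odot>\<^bsub>V\<^esub> v"
  shows "tensor_class A V (frag_of (a, v)) \<in> equivariant_tensors A \<alpha> V \<pi>"
proof -
  interpret dynamical_system A T \<alpha> by fact
  interpret V: continuous_representation V S \<pi> by fact
  note mods = module_axioms V.module_axioms
  have a': "a \<in> carrier A" "\<alpha> g a = \<psi> g \<odot>\<^bsub>A\<^esub> a" for g
    using a by (auto simp: isotypic_component_def)
  have "linear_endo A (\<alpha> g)" for g
    using action_aut[of g] by (simp add: algebra_aut_def)
  moreover have "linear_endo A id" "linear_endo V id"
    by (auto simp: linear_endo_def)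
  moreover have "tensor_class A V (frag_of (\<psi> g \<odot>\<^bsub>A\<^esub> a, v)) = tensor_class A V (frag_of (a, \<psi> g \<odot>\<^bsub>V\<^esub> v))" for g
  proof (rule tensor_class_eqI[OF mods])
    show "frag_of (\<psi> g \<odot>\<^bsub>A\<^esub> a, v) - frag_of (a, \<psi> g \<odot>\<^bsub>V\<^esub> v) \<in> tensor_kernel A V"
      unfolding tensor_kernel_def tensor_relations_def
      using a'(1) v(1) by (intro generate.incl) blast
  qed
  moreover have "tensor_class A V (frag_of (a, v)) \<in> carrier (tensor_product A V)"
    unfolding carrier_tensor_product[OF mods] using a'(1) v(1) by (intro imageI) simp
  ultimately show ?thesis
    by (simp add: equivariant_tensors_def tensor_map_class[OF mods] V.rep_linear a' v)
qed

lemma algebra_character_unit_nonzero: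
  assumes "Ring.ring A" "\<omega> \<in> algebra_characters A" "a \<in> Units A"
  shows "\<omega> a \<noteq> 0"
proof
  interpret Ring.ring A by fact
  assume "\<omega> a = 0"
  obtain b where b: "b \<in> carrier A" "a \<otimes>\<^bsub>A\<^esub> b = \<one>\<^bsub>A\<^esub>"
    using assms(3) unfolding Units_def by blast
  have mult: "\<omega> (x \<otimes>\<^bsub>A\<^esub> y) = \<omega> x * \<omega> y" if "x \<in> carrier A" "y \<in> carrier A" for x y
    using assms(2) that by (simp add: algebra_characters_def)
  obtain x where x: "x \<in> carrier A" "\<omega> x \<noteq> 0"
    using assms(2) by (auto simp: algebra_characters_def)
  have "\<omega> \<one>\<^bsub>A\<^esub> = 0"
    using mult[OF Units_closed[OF assms(3)] b(1)] b(2) \<open>\<omega> a = 0\<close> by simp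
  then have "\<omega> x = 0"
    using mult[OF one_closed x(1)] x(1) by simp
  with x(2) show False by simp
qed

text \<open>
  Equivariance compares \<open>\<alpha> g\<close> with the action of \<open>- g\<close>, so a pure tensor with the line on which
  \<open>g\<close> acts by \<open>\<phi> g\<close> is equivariant if its algebra part is isotypic for the inverse character
  \<open>g \<mapsto> \<phi> (- g)\<close>. Being a unit, \<open>a\<close> is not annihilated by \<open>\<omega>\<close>, and the value \<open>c\<close> is attained at
  the tensor of \<open>a\<close> and \<open>c / \<omega> a\<close>.
\<close>

lemma tensor_eval_line_surjective:
  fixes A :: "(complex, 'a) module" and \<alpha> :: "'g::topological_ab_group_add \<Rightarrow> 'a \<Rightarrow> 'a"
  assumes sys: "dynamical_system A T \<alpha>" and \<omega>: "\<omega> \<in> algebra_characters A"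
    and \<phi>: "\<phi> \<in> group_characters"
    and unit: "a \<in> isotypic_component A \<alpha> (\<lambda>g. \<phi> (- g))" "a \<in> Units A"
  shows "tensor_eval complex_line \<omega> ` equivariant_tensors A \<alpha> complex_line (line_rep \<phi>) =
    carrier (complex_line :: (complex, 'p \<Rightarrow> complex) module)"
proof
  interpret dynamical_system A T \<alpha> by fact
  note mods = module_axioms module_complex_line[where 'p = 'p]
  show "tensor_eval complex_line \<omega> ` equivariant_tensors A \<alpha> complex_line (line_rep \<phi>)
      \<subseteq> carrier (complex_line :: (complex, 'p \<Rightarrow> complex) module)"
    by (auto simp: equivariant_tensors_def carrier_tensor_product[OF mods]
        tensor_eval_line[OF module_axioms \<omega>] complex_line_simps)
  show "carrier (complex_line :: (complex, 'p \<Rightarrow> complex) module)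
      \<subseteq> tensor_eval complex_line \<omega> ` equivariant_tensors A \<alpha> complex_line (line_rep \<phi>)"
  proof
    fix v :: "'p \<Rightarrow> complex" assume "v \<in> carrier complex_line"
    then obtain c where v: "v = (\<lambda>p. c)" by (auto simp: complex_line_simps)
    let ?w = "\<lambda>p :: 'p. c / \<omega> a"
    have "\<omega> a \<noteq> 0"
      by (rule algebra_character_unit_nonzero[OF ring_axioms \<omega> unit(2)])
    have "tensor_class A complex_line (frag_of (a, ?w)) \<in> equivariant_tensors A \<alpha> complex_line (line_rep \<phi>)"
      by (rule equivariant_pure_tensor[OF sys continuous_representation_line[OF \<phi>] unit(1)])
         (auto simp: complex_line_simps line_rep_def)
    moreover have "tensor_eval complex_line \<omega> (tensor_class A complex_line (frag_of (a, ?w))) = v"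
      using \<open>\<omega> a \<noteq> 0\<close> unit(1)
      by (subst tensor_eval_line[OF module_axioms \<omega>])
         (auto simp: isotypic_component_def complex_line_simps v)
    ultimately show "v \<in> tensor_eval complex_line \<omega> ` equivariant_tensors A \<alpha> complex_line (line_rep \<phi>)"
      by (metis imageI)
  qed
qed

lemma group_character_reflect:
  fixes \<phi> :: "'g::topological_ab_group_add \<Rightarrow> complex"
  assumes "\<phi> \<in> group_characters"
  shows "(\<lambda>g. \<phi> (- g)) \<in> group_characters"
proof -
  have "\<phi> (- g + - h) = \<phi> (- g) * \<phi> (- h)" for g h
    using assms unfolding group_characters_def by blast
  then have "\<phi> (- (g + h)) = \<phi> (- g) * \<phi> (- h)" for g h
    by simp
  moreover have "continuous_on UNIV (\<lambda>g. \<phi> (- g))"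
    by (rule continuous_on_compose2[of UNIV \<phi>])
       (use assms in \<open>auto simp: group_characters_def intro!: continuous_intros\<close>)
  ultimately show ?thesis
    using assms by (simp add: group_characters_def)
qed

theorem proposition6p5p12:
  fixes A :: "(complex, 'a) module"
    and T :: "'a topology"
    and \<alpha> :: "'g::{topological_ab_group_add, t2_space} \<Rightarrow> 'a \<Rightarrow> 'a"
  assumes "compact (UNIV :: 'g set)"
    and "cring A"
    and "dynamical_system A T \<alpha>"
    and "\<And>\<phi>. \<phi> \<in> group_characters \<Longrightarrow> isotypic_component A \<alpha> \<phi> \<inter> Units A \<noteq> {}"
  shows "free_system A \<alpha>"
proof -
  let ?L = "complex_line :: (complex, 'a \<times> 'g \<Rightarrow> complex) module"
  let ?\<R> = "{(?L, line_topology, line_rep \<phi>) |\<phi>. \<phi> \<in> (group_characters :: ('g \<Rightarrow> complex) set)}"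
  have "\<exists>\<phi>\<in>group_characters. \<exists>v\<in>carrier ?L. line_rep \<phi> g v \<noteq> v" if "g \<noteq> 0" for g :: 'g
  proof -
    obtain \<phi> where \<phi>: "\<phi> \<in> group_characters" "\<phi> g \<noteq> 1"
      by (rule group_characters_separate[OF assms(1) \<open>g \<noteq> 0\<close>])
    then show ?thesis
      by (intro bexI[of _ \<phi>] bexI[of _ "\<lambda>p. 1"]) (auto simp: line_rep_def complex_line_simps fun_eq_iff)
  qed
  moreover have "tensor_eval ?L \<omega> ` equivariant_tensors A \<alpha> ?L (line_rep \<phi>) = carrier ?L"
    if "\<phi> \<in> group_characters" "\<omega> \<in> algebra_characters A" for \<phi> \<omega>
    using assms(4)[OF group_character_reflect[OF that(1)]]
      tensor_eval_line_surjective[OF assms(3) that(2,1)] by blast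
  ultimately show ?thesis
    unfolding free_system_def
    by (intro exI[of _ ?\<R>]) (fastforce intro: continuous_representation_line)
qed

end
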